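(* Let $k=\mathbb F_2$, let $Q=\langle X,E\rangle$ be a graph with a chosen edge $\tilde e=\{\tilde x,\tilde y\}$, and let $\Gamma(Q),\Gamma'(Q)$ be the two $2$-colored Cai–Fürer–Immerman graphs on the common colored vertex set $X(Q)=X_1(Q)\cup X_2(Q)$. If $\Gamma(Q)$ and $\Gamma'(Q)$ are nonisomorphic, then there exists a $3$-constructible functor $\mathcal F:\mathcal C_3(V)\to\mathcal C_3(V')$ with $\dim\mathcal F(\{A_{\Gamma(Q)}\})\ne\dim\mathcal F(\{A_{\Gamma'(Q)}\})$. In particular $A_{\Gamma(Q)}$ and $A_{\Gamma'(Q)}$ are not isomorphic in $\mathcal C_3(V)$.
   Context: CFI construction: $E(x)$ is the set of edges containing $x$. $X_1(Q)=\{c_{x,Y}:x\in X, Y\subseteq E(x),|Y|\text{ even}\}$, $X_2(Q)=\{a_{x,e},b_{x,e}:x\in X,e\in E(x)\}$. The edge set $E(Q)$ consists of $\{a_{x,e},c_{x,Y}\}$ for $e\in Y$, $\{b_{x,e},c_{x,Y}\}$ for $e\in E(x)\setminus Y$, and $\{a_{x,e},a_{y,e}\}$, $\{b_{x,e},b_{y,e}\}$ for every edge $e=\{x,y\}\in E$. $E'(Q)$ is obtained from $E(Q)$ by removing $\{a_{\tilde x,\tilde e},a_{\tilde y,\tilde e}\}$ and $\{b_{\tilde x,\tilde e},b_{\tilde y,\tilde e}\}$ and adding $\{a_{\tilde x,\tilde e},b_{\tilde y,\tilde e}\}$ and $\{a_{\tilde y,\tilde e},b_{\tilde x,\tilde e}\}$.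 $\Gamma(Q)$ (resp. $\Gamma'(Q)$) is the graph on $X(Q)$ with edges $E(Q)$ (resp. $E'(Q)$) and color classes $X_1(Q),X_2(Q)$; isomorphisms must preserve colors. Encoding: $G=\Sigma(X(Q))$ as a finite constant algebraic group over $k$ ($R=k[G]$ functions on $G$, $\Delta f(g,h)=f(gh)$, $\sigma_e f=f(e)$, $\iota f(g)=f(g^{-1})$); $U=k^{X(Q)}$ with permutation action; $W$ = span of the constant $1$ and matrix coefficients $g\mapsto g_{u,v}$; $R_0=k$, $R_d=W^d$. $V=U\otimes U\oplus U\oplus U\oplus k$ and for a colored graph $\Gamma$ with symmetric edge relation $\mathcal R$, $A_\Gamma=(\sum_{(u,v)\in\mathcal R}u\otimes v,\ \sum_{u\in X_1(Q)}u,\ \sum_{u\in X_2(Q)}u,\ 1)$. A representation is a coassociative counital $\mu:V\to V\otimes R$; $\ell(V)$ is the least $\ell$ with $\mu(V)\subseteq V\otimes R_\ell$; linear $f$ is equivariant if $\mu'\circ f=(f\otimes\mathrm{id})\circ\mu$. $\mathcal C_3(V)$: for a subspace $S\subseteq R_3$, $(S)_3=\sum_{e\le3}(S\cap R_e)R_{3-e}$, $((S))_3$ = smallest $J\supseteq S$ with $(J)_3=J$. Objects: affine subspaces of $V$ (incl. $\emptyset$; $v\equiv\{v\}$). For nonempty $X_1=v_1+Z_1,X_2=v_2+Z_2$, $S(X_1,X_2)$ = span of $(f\otimes\mathrm{id})\mu(w)-f(v_2)1$, $f\in V^*$ vanishing on $Z_2$, $w\in X_1$; $S(\emptyset,\cdot)=0$,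 $S(X,\emptyset)=k1$. $\operatorname{Hom}_3(X_1,X_2)=(R_3/((S(X_1,X_2)))_3)^*\subseteq R_3^*$, composition $r\mapsto(\psi\otimes\varphi)\Delta(r)$. $3$-constructible functors: smallest class of very faithful functors (covariant: $\phi\mapsto\phi$; contravariant: $\phi\mapsto\phi\circ\iota$; between $\mathcal C_3(V),\mathcal C_3(V')$ with $\ell\le3$) containing constant covariant functors with values $\emptyset,\{0\},V',\{\lambda\}\in\operatorname{Aff}(k)$, $X\mapsto f(X)$ for equivariant linear $f$, the contravariant $X\mapsto\{f\in V^*:f|_X\equiv1\}$, and closed under $X\mapsto\mathcal F'(X)\oplus\mathcal F''(X)$, $X\mapsto\mathcal F'(X)\otimes\mathcal F''(X)$ (affine span of all $y\otimes y'$; needs $\ell(V')+\ell(V'')\le3$; same variance), and composition. $\dim\emptyset=-\infty$. *)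

theory Defs
  imports
    Complex_Main
    "HOL-Library.Z2"
    "HOL-Library.FuncSet"
    "HOL-Library.Function_Algebras"
    "HOL-Library.Extended_Real"
    "HOL-Combinatorics.Permutations"
begin

section \<open>Coordinate vector spaces and their affine subspaces\<close>

definition fscale :: "'k::field \<Rightarrow> ('i \<Rightarrow> 'k) \<Rightarrow> 'i \<Rightarrow> 'k" where
  "fscale c v = (\<lambda>i. c * v i)"

global_interpretation fvs: vector_space "fscale :: 'k::field \<Rightarrow> ('i \<Rightarrow> 'k) \<Rightarrow> 'i \<Rightarrow> 'k"
  by standard (auto simp: fscale_def fun_eq_iff algebra_simps)

definition basis_vec :: "'i \<Rightarrow> 'i \<Rightarrow> 'k::field" where
  "basis_vec i = (\<lambda>j. if j = i then 1 else 0)"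

text \<open>Linearity of a map of which only the values on the subspace \<open>A\<close> matter.\<close>

definition linear_on ::
  "'a set \<Rightarrow> ('k \<Rightarrow> 'a \<Rightarrow> 'a) \<Rightarrow> ('k \<Rightarrow> 'b \<Rightarrow> 'b) \<Rightarrow> ('a::plus \<Rightarrow> 'b::plus) \<Rightarrow> bool" where
  "linear_on A s t f \<longleftrightarrow>
     (\<forall>u\<in>A. \<forall>v\<in>A. f (u + v) = f u + f v) \<and> (\<forall>c. \<forall>v\<in>A. f (s c v) = t c (f v))"

definition affine_set :: "('i \<Rightarrow> 'k::field) set \<Rightarrow> bool" where
  "affine_set X \<longleftrightarrow> X = {} \<or> (\<exists>v Z. fvs.subspace Z \<and> X = (\<lambda>z. v + z) ` Z)"

text \<open>The subspace \<open>Z\<close> of a nonempty affine subspace \<open>v + Z\<close>.\<close>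

definition direction :: "('i \<Rightarrow> 'k::field) set \<Rightarrow> ('i \<Rightarrow> 'k) set" where
  "direction X = {x - y | x y. x \<in> X \<and> y \<in> X}"

definition affine_dim :: "('i \<Rightarrow> 'k::field) set \<Rightarrow> ereal" where
  "affine_dim X = (if X = {} then -\<infinity> else ereal (real (fvs.dim (direction X))))"


section \<open>The coordinate ring of a symmetric group and its filtration\<close>

text \<open>
  The group is \<open>symgrp \<Omega>\<close>. An element of its coordinate ring is a function on all self-maps of the
  vertex type that vanishes outside the group; the unit of the ring is therefore \<open>unitR \<Omega>\<close> and not
  the constant function \<open>1\<close>. Ring multiplication is pointwise multiplication, and
  \<open>k[G] \<otimes> k[G]\<close> is identified with the functions on \<open>G \<times> G\<close>.
\<close>

definition symgrp :: "'v set \<Rightarrow> ('v \<Rightarrow> 'v) set" where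
  "symgrp \<Omega> = {g. g permutes \<Omega>}"

definition coordR :: "'v set \<Rightarrow> (('v \<Rightarrow> 'v) \<Rightarrow> 'k::field) set" where
  "coordR \<Omega> = {r. \<forall>g. g \<notin> symgrp \<Omega> \<longrightarrow> r g = 0}"

definition unitR :: "'v set \<Rightarrow> ('v \<Rightarrow> 'v) \<Rightarrow> 'k::field" where
  "unitR \<Omega> = (\<lambda>g. if g \<in> symgrp \<Omega> then 1 else 0)"

definition comult :: "'v set \<Rightarrow> (('v \<Rightarrow> 'v) \<Rightarrow> 'k::field) \<Rightarrow> ('v \<Rightarrow> 'v) \<times> ('v \<Rightarrow> 'v) \<Rightarrow> 'k" where
  "comult \<Omega> r = (\<lambda>(g, h). if g \<in> symgrp \<Omega> \<and> h \<in> symgrp \<Omega> then r (g \<circ> h) else 0)"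

definition counit :: "(('v \<Rightarrow> 'v) \<Rightarrow> 'k::field) \<Rightarrow> 'k" where
  "counit r = r id"

definition antipode :: "'v set \<Rightarrow> (('v \<Rightarrow> 'v) \<Rightarrow> 'k::field) \<Rightarrow> ('v \<Rightarrow> 'v) \<Rightarrow> 'k" where
  "antipode \<Omega> r = (\<lambda>g. if g \<in> symgrp \<Omega> then r (inv g) else 0)"

text \<open>The entry \<open>g\<^sub>u\<^sub>,\<^sub>v\<close> of the permutation matrix with \<open>g e\<^sub>v = e\<^sub>g\<^sub>v\<close>.\<close>

definition mat_coeff :: "'v set \<Rightarrow> 'v \<Rightarrow> 'v \<Rightarrow> ('v \<Rightarrow> 'v) \<Rightarrow> 'k::field" where
  "mat_coeff \<Omega> u v = (\<lambda>g. if g \<in> symgrp \<Omega> \<and> g v = u then 1 else 0)"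

definition genW :: "'v set \<Rightarrow> (('v \<Rightarrow> 'v) \<Rightarrow> 'k::field) set" where
  "genW \<Omega> = fvs.span (insert (unitR \<Omega>) {mat_coeff \<Omega> u v | u v. u \<in> \<Omega> \<and> v \<in> \<Omega>})"

definition subspace_prod :: "('g \<Rightarrow> 'k::field) set \<Rightarrow> ('g \<Rightarrow> 'k) set \<Rightarrow> ('g \<Rightarrow> 'k) set" where
  "subspace_prod S T = fvs.span {s * t | s t. s \<in> S \<and> t \<in> T}"

fun filtR :: "'v set \<Rightarrow> nat \<Rightarrow> (('v \<Rightarrow> 'v) \<Rightarrow> 'k::field) set" where
  "filtR \<Omega> 0 = fvs.span {unitR \<Omega>}"
| "filtR \<Omega> (Suc d) = subspace_prod (filtR \<Omega> d) (genW \<Omega>)"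

definition trunc :: "'v set \<Rightarrow> nat \<Rightarrow> (('v \<Rightarrow> 'v) \<Rightarrow> 'k::field) set \<Rightarrow> (('v \<Rightarrow> 'v) \<Rightarrow> 'k) set" where
  "trunc \<Omega> d S = fvs.span (\<Union>e\<le>d. subspace_prod (S \<inter> filtR \<Omega> e) (filtR \<Omega> (d - e)))"

definition trunc_ideal ::
  "'v set \<Rightarrow> nat \<Rightarrow> (('v \<Rightarrow> 'v) \<Rightarrow> 'k::field) set \<Rightarrow> (('v \<Rightarrow> 'v) \<Rightarrow> 'k) set" where
  "trunc_ideal \<Omega> d S =
     (\<lambda>J. fvs.subspace J \<and> J \<subseteq> filtR \<Omega> d \<and> trunc \<Omega> d J = J) hull S"


section \<open>Representations\<close>

text \<open>
  A finite-dimensional vector space is taken in the form \<open>k\<^sup>B\<close> with \<open>B\<close> a finite set of labels from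
  a fixed type which is closed under the label operations needed for tensor products and direct
  sums. Every finite-dimensional representation is isomorphic to one of this form.
\<close>

datatype 'v label = Pt 'v | Unit | Tens "'v label" "'v label" | SumL "'v label" | SumR "'v label"

type_synonym ('v, 'k) vec = "'v label \<Rightarrow> 'k"

text \<open>
  An element of \<open>k\<^sup>B \<otimes> k[G]\<close> is the function \<open>t\<close> that sends each label to a coefficient in \<open>k[G]\<close>,
  so that it stands for the sum of all \<open>e\<^sub>i \<otimes> t i\<close>, \<open>i \<in> B\<close>.
\<close>

record ('v, 'k) rep =
  labels :: "'v label set"
  coact :: "('v, 'k) vec \<Rightarrow> 'v label \<Rightarrow> ('v \<Rightarrow> 'v) \<Rightarrow> 'k"

definition vspace :: "('v, 'k::field) rep \<Rightarrow> ('v, 'k) vec set" where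
  "vspace V = {v. \<forall>i. i \<notin> labels V \<longrightarrow> v i = 0}"

definition tensor_space ::
  "('v, 'k::field) rep \<Rightarrow> (('v \<Rightarrow> 'v) \<Rightarrow> 'k) set \<Rightarrow> ('v label \<Rightarrow> ('v \<Rightarrow> 'v) \<Rightarrow> 'k) set" where
  "tensor_space V S = {t. (\<forall>i\<in>labels V. t i \<in> S) \<and> (\<forall>i. i \<notin> labels V \<longrightarrow> t i = 0)}"

text \<open>\<open>f \<otimes> id\<close> and \<open>\<mu> \<otimes> id\<close> on \<open>V \<otimes> k[G]\<close>, for linear \<open>f: V \<rightarrow> V'\<close> and \<open>\<mu>: V \<rightarrow> V \<otimes> k[G]\<close>.\<close>

definition map_tensor_id ::
  "('v, 'k::field) rep \<Rightarrow> (('v, 'k) vec \<Rightarrow> ('v, 'k) vec) \<Rightarrow>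
   ('v label \<Rightarrow> ('v \<Rightarrow> 'v) \<Rightarrow> 'k) \<Rightarrow> 'v label \<Rightarrow> ('v \<Rightarrow> 'v) \<Rightarrow> 'k" where
  "map_tensor_id V f t = (\<lambda>j g. \<Sum>i\<in>labels V. f (basis_vec i) j * t i g)"

definition coact_tensor_id ::
  "('v, 'k::field) rep \<Rightarrow> ('v label \<Rightarrow> ('v \<Rightarrow> 'v) \<Rightarrow> 'k) \<Rightarrow>
   'v label \<Rightarrow> ('v \<Rightarrow> 'v) \<times> ('v \<Rightarrow> 'v) \<Rightarrow> 'k" where
  "coact_tensor_id V t = (\<lambda>j (g, h). \<Sum>i\<in>labels V. coact V (basis_vec i) j g * t i h)"

definition representation :: "'v set \<Rightarrow> ('v, 'k::field) rep \<Rightarrow> bool" where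
  "representation \<Omega> V \<longleftrightarrow>
     finite (labels V) \<and>
     linear_on (vspace V) fscale (\<lambda>c t i. fscale c (t i)) (coact V) \<and>
     (\<forall>v\<in>vspace V. coact V v \<in> tensor_space V (coordR \<Omega>)) \<and>
     (\<forall>v\<in>vspace V. coact_tensor_id V (coact V v) = (\<lambda>j. comult \<Omega> (coact V v j))) \<and>
     (\<forall>v\<in>vspace V. (\<lambda>j. counit (coact V v j)) = v)"

definition ell :: "'v set \<Rightarrow> ('v, 'k::field) rep \<Rightarrow> nat" where
  "ell \<Omega> V = (LEAST l. \<forall>v\<in>vspace V. coact V v \<in> tensor_space V (filtR \<Omega> l))"

definition equivariant ::
  "('v, 'k::field) rep \<Rightarrow> ('v, 'k) rep \<Rightarrow> (('v, 'k) vec \<Rightarrow> ('v, 'k) vec) \<Rightarrow> bool" where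
  "equivariant V V' f \<longleftrightarrow>
     f ` vspace V \<subseteq> vspace V' \<and> linear_on (vspace V) fscale fscale f \<and>
     (\<forall>v\<in>vspace V. coact V' (f v) = map_tensor_id V f (coact V v))"

definition perm_rep :: "'v set \<Rightarrow> ('v, 'k::field) rep" where
  "perm_rep \<Omega> = \<lparr>labels = Pt ` \<Omega>,
     coact = (\<lambda>x i. case i of
        Pt u \<Rightarrow> if u \<in> \<Omega> then \<Sum>v\<in>\<Omega>. fscale (x (Pt v)) (mat_coeff \<Omega> u v) else 0
      | _ \<Rightarrow> 0)\<rparr>"

definition triv_rep :: "'v set \<Rightarrow> ('v, 'k::field) rep" where
  "triv_rep \<Omega> = \<lparr>labels = {Unit},
     coact = (\<lambda>x i. if i = Unit then fscale (x Unit) (unitR \<Omega>) else 0)\<rparr>"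

definition sum_vec :: "('v, 'k::field) vec \<Rightarrow> ('v, 'k) vec \<Rightarrow> ('v, 'k) vec" where
  "sum_vec x y = (\<lambda>l. case l of SumL i \<Rightarrow> x i | SumR i \<Rightarrow> y i | _ \<Rightarrow> 0)"

definition sum_rep :: "('v, 'k::field) rep \<Rightarrow> ('v, 'k) rep \<Rightarrow> ('v, 'k) rep" where
  "sum_rep V V' = \<lparr>labels = SumL ` labels V \<union> SumR ` labels V',
     coact = (\<lambda>x l. case l of
        SumL i \<Rightarrow> coact V (\<lambda>j. x (SumL j)) i
      | SumR i \<Rightarrow> coact V' (\<lambda>j. x (SumR j)) i
      | _ \<Rightarrow> 0)\<rparr>"

definition tensor_vec :: "('v, 'k::field) vec \<Rightarrow> ('v, 'k) vec \<Rightarrow> ('v, 'k) vec" where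
  "tensor_vec x y = (\<lambda>l. case l of Tens i j \<Rightarrow> x i * y j | _ \<Rightarrow> 0)"

definition tensor_rep :: "('v, 'k::field) rep \<Rightarrow> ('v, 'k) rep \<Rightarrow> ('v, 'k) rep" where
  "tensor_rep V V' = \<lparr>labels = {Tens i j | i j. i \<in> labels V \<and> j \<in> labels V'},
     coact = (\<lambda>x l. case l of
        Tens i' j' \<Rightarrow> \<Sum>i\<in>labels V. \<Sum>j\<in>labels V'.
          fscale (x (Tens i j)) (coact V (basis_vec i) i' * coact V' (basis_vec j) j')
      | _ \<Rightarrow> 0)\<rparr>"

text \<open>
  \<open>V\<^sup>*\<close> is \<open>k\<^sup>B\<close> in the coordinates of the dual basis, and \<open>(g f)(v) = f (g\<^sup>-\<^sup>1 v)\<close>.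
\<close>

definition pairing :: "('v, 'k::field) rep \<Rightarrow> ('v, 'k) vec \<Rightarrow> ('v, 'k) vec \<Rightarrow> 'k" where
  "pairing V f v = (\<Sum>i\<in>labels V. f i * v i)"

text \<open>\<open>f \<otimes> id: V \<otimes> k[G] \<rightarrow> k[G]\<close> for \<open>f \<in> V\<^sup>*\<close>.\<close>

definition pairing_tensor_id ::
  "('v, 'k::field) rep \<Rightarrow> ('v, 'k) vec \<Rightarrow> ('v label \<Rightarrow> ('v \<Rightarrow> 'v) \<Rightarrow> 'k) \<Rightarrow> ('v \<Rightarrow> 'v) \<Rightarrow> 'k" where
  "pairing_tensor_id V f t = (\<Sum>i\<in>labels V. fscale (f i) (t i))"

definition dual_rep :: "'v set \<Rightarrow> ('v, 'k::field) rep \<Rightarrow> ('v, 'k) rep" where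
  "dual_rep \<Omega> V = \<lparr>labels = labels V,
     coact = (\<lambda>f j. if j \<in> labels V
        then antipode \<Omega> (pairing_tensor_id V f (coact V (basis_vec j))) else 0)\<rparr>"


section \<open>The approximate category of a representation\<close>

record ('o, 'm) precat =
  Obj :: "'o set"
  Hom :: "'o \<Rightarrow> 'o \<Rightarrow> 'm set"
  Id :: "'o \<Rightarrow> 'm"
  Comp :: "'m \<Rightarrow> 'm \<Rightarrow> 'm"

definition opposite :: "('o, 'm) precat \<Rightarrow> ('o, 'm) precat" where
  "opposite C = C\<lparr>Hom := (\<lambda>X Y. Hom C Y X), Comp := (\<lambda>\<psi> \<phi>. Comp C \<phi> \<psi>)\<rparr>"

definition isomorphic_in :: "('o, 'm) precat \<Rightarrow> 'o \<Rightarrow> 'o \<Rightarrow> bool" where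
  "isomorphic_in C X Y \<longleftrightarrow>
     (\<exists>\<phi>\<in>Hom C X Y. \<exists>\<psi>\<in>Hom C Y X. Comp C \<psi> \<phi> = Id C X \<and> Comp C \<phi> \<psi> = Id C Y)"

definition is_functor ::
  "('o, 'm) precat \<Rightarrow> ('p, 'n) precat \<Rightarrow> ('o \<Rightarrow> 'p) \<Rightarrow> ('m \<Rightarrow> 'n) \<Rightarrow> bool" where
  "is_functor C D F M \<longleftrightarrow>
     (\<forall>X\<in>Obj C. F X \<in> Obj D) \<and>
     (\<forall>X\<in>Obj C. \<forall>Y\<in>Obj C. \<forall>\<phi>\<in>Hom C X Y. M \<phi> \<in> Hom D (F X) (F Y)) \<and>
     (\<forall>X\<in>Obj C. M (Id C X) = Id D (F X)) \<and>
     (\<forall>X\<in>Obj C. \<forall>Y\<in>Obj C. \<forall>Z\<in>Obj C. \<forall>\<phi>\<in>Hom C X Y. \<forall>\<psi>\<in>Hom C Y Z.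
        M (Comp C \<psi> \<phi>) = Comp D (M \<psi>) (M \<phi>))"

text \<open>
  For \<open>X\<^sub>2 = v\<^sub>2 + Z\<^sub>2\<close>, a functional that vanishes on \<open>Z\<^sub>2\<close> is constant on \<open>X\<^sub>2\<close>, so all points
  \<open>v\<^sub>2\<close> of \<open>X\<^sub>2\<close> give the same generators.
\<close>

definition relS ::
  "'v set \<Rightarrow> ('v, 'k::field) rep \<Rightarrow> ('v, 'k) vec set \<Rightarrow> ('v, 'k) vec set \<Rightarrow> (('v \<Rightarrow> 'v) \<Rightarrow> 'k) set" where
  "relS \<Omega> V X\<^sub>1 X\<^sub>2 =
     (if X\<^sub>1 = {} then {0}
      else if X\<^sub>2 = {} then fvs.span {unitR \<Omega>}
      else fvs.span {pairing_tensor_id V f (coact V w) - fscale (pairing V f v\<^sub>2) (unitR \<Omega>)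
             | f w v\<^sub>2. f \<in> vspace V \<and> (\<forall>z\<in>direction X\<^sub>2. pairing V f z = 0) \<and> w \<in> X\<^sub>1 \<and> v\<^sub>2 \<in> X\<^sub>2})"

definition dual_filtR :: "'v set \<Rightarrow> nat \<Rightarrow> ((('v \<Rightarrow> 'v) \<Rightarrow> 'k::field) \<Rightarrow> 'k) set" where
  "dual_filtR \<Omega> d = {\<phi>. \<phi> \<in> extensional (filtR \<Omega> d) \<and> linear_on (filtR \<Omega> d) fscale (*) \<phi>}"

text \<open>\<open>\<psi> \<otimes> \<phi>\<close>; it maps \<open>\<Sum>i. a\<^sub>i \<otimes> b\<^sub>i\<close> to \<open>\<Sum>i. \<psi> a\<^sub>i * \<phi> b\<^sub>i\<close>, see \<open>functional_tensor_sum\<close> below.\<close>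

definition functional_tensor ::
  "(('g \<Rightarrow> 'k::field) \<Rightarrow> 'k) \<Rightarrow> (('g \<Rightarrow> 'k) \<Rightarrow> 'k) \<Rightarrow> ('g \<times> 'g \<Rightarrow> 'k) \<Rightarrow> 'k" where
  "functional_tensor \<psi> \<phi> t = \<psi> (\<lambda>g. \<phi> (\<lambda>h. t (g, h)))"

lemma linear_on_sum:
  assumes S: "fvs.subspace S" and lin: "linear_on S fscale (*) \<phi>"
    and I: "finite I" and a: "\<And>i. i \<in> I \<Longrightarrow> a i \<in> S"
  shows "\<phi> (\<Sum>i\<in>I. fscale (c i) (a i)) = (\<Sum>i\<in>I. c i * \<phi> (a i))"
  using I a
proof (induction I rule: finite_induct)
  case empty
  have "\<phi> (fscale 0 0) = 0 * \<phi> 0"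
    using lin fvs.subspace_0[OF S] unfolding linear_on_def by blast
  then show ?case by (simp add: zero_fun_def)
next
  case (insert x F)
  have "fscale (c x) (a x) \<in> S" "(\<Sum>i\<in>F. fscale (c i) (a i)) \<in> S"
    using insert.prems by (auto intro!: fvs.subspace_scale fvs.subspace_sum S)
  moreover have "a x \<in> S" using insert.prems by simp
  ultimately have "\<phi> (fscale (c x) (a x) + (\<Sum>i\<in>F. fscale (c i) (a i))) =
      c x * \<phi> (a x) + \<phi> (\<Sum>i\<in>F. fscale (c i) (a i))"
    using lin unfolding linear_on_def by metis
  then show ?case
    using insert by (simp only: sum.insert insert_iff simp_thms)
qed

lemma functional_tensor_sum:
  fixes a b :: "'i \<Rightarrow> 'g \<Rightarrow> 'k::field"
  assumes S: "fvs.subspace S"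
    and \<psi>: "linear_on S fscale (*) \<psi>" and \<phi>: "linear_on S fscale (*) \<phi>"
    and I: "finite I" and a: "\<And>i. i \<in> I \<Longrightarrow> a i \<in> S" and b: "\<And>i. i \<in> I \<Longrightarrow> b i \<in> S"
  shows "functional_tensor \<psi> \<phi> (\<lambda>(g, h). \<Sum>i\<in>I. a i g * b i h) = (\<Sum>i\<in>I. \<psi> (a i) * \<phi> (b i))"
proof -
  have sum_fun: "(\<Sum>i\<in>J. f i) = (\<lambda>x. \<Sum>i\<in>J. f i x)" for J and f :: "'i \<Rightarrow> 'g \<Rightarrow> 'k"
    by (induction J rule: infinite_finite_induct) (auto simp: fun_eq_iff)
  have "(\<lambda>h. \<Sum>i\<in>I. a i g * b i h) = (\<Sum>i\<in>I. fscale (a i g) (b i))" for g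
    by (simp add: sum_fun fscale_def)
  then have "\<phi> (\<lambda>h. \<Sum>i\<in>I. a i g * b i h) = (\<Sum>i\<in>I. a i g * \<phi> (b i))" for g
    using linear_on_sum[OF S \<phi> I b] by simp
  moreover have "(\<lambda>g. \<Sum>i\<in>I. a i g * \<phi> (b i)) = (\<Sum>i\<in>I. fscale (\<phi> (b i)) (a i))"
    by (simp add: sum_fun fscale_def mult.commute)
  ultimately show ?thesis
    using linear_on_sum[OF S \<psi> I a] by (simp add: functional_tensor_def mult.commute)
qed

text \<open>
  The dual of the quotient of \<open>filtR \<Omega> d\<close> by the truncated ideal is the space of functionals that
  vanish on the ideal. The identity morphism is the counit.
\<close>

definition approx_cat ::
  "'v set \<Rightarrow> nat \<Rightarrow> ('v, 'k::field) rep \<Rightarrow> (('v, 'k) vec set, (('v \<Rightarrow> 'v) \<Rightarrow> 'k) \<Rightarrow> 'k) precat" where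
  "approx_cat \<Omega> d V = \<lparr>
     Obj = {X. X \<subseteq> vspace V \<and> affine_set X},
     Hom = (\<lambda>X\<^sub>1 X\<^sub>2. {\<phi> \<in> dual_filtR \<Omega> d. \<forall>r\<in>trunc_ideal \<Omega> d (relS \<Omega> V X\<^sub>1 X\<^sub>2). \<phi> r = 0}),
     Id = (\<lambda>X. restrict counit (filtR \<Omega> d)),
     Comp = (\<lambda>\<psi> \<phi>. restrict (\<lambda>r. functional_tensor \<psi> \<phi> (comult \<Omega> r)) (filtR \<Omega> d))\<rparr>"


section \<open>Constructible functors\<close>

text \<open>
  A very faithful functor is determined by its variance and its action on objects.
\<close>

datatype variance = Covariant | Contravariant

fun comp_variance :: "variance \<Rightarrow> variance \<Rightarrow> variance" where
  "comp_variance Covariant c = c"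
| "comp_variance Contravariant Covariant = Contravariant"
| "comp_variance Contravariant Contravariant = Covariant"

fun very_faithful ::
  "'v set \<Rightarrow> nat \<Rightarrow> variance \<Rightarrow> ('v, 'k::field) rep \<Rightarrow> ('v, 'k) rep \<Rightarrow>
   (('v, 'k) vec set \<Rightarrow> ('v, 'k) vec set) \<Rightarrow> bool" where
  "very_faithful \<Omega> d Covariant V V' F \<longleftrightarrow>
     is_functor (approx_cat \<Omega> d V) (approx_cat \<Omega> d V') F (\<lambda>\<phi>. \<phi>)"
| "very_faithful \<Omega> d Contravariant V V' F \<longleftrightarrow>
     is_functor (opposite (approx_cat \<Omega> d V)) (approx_cat \<Omega> d V') F
       (\<lambda>\<phi>. restrict (\<lambda>r. \<phi> (antipode \<Omega> r)) (filtR \<Omega> d))"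

definition rep_le :: "'v set \<Rightarrow> nat \<Rightarrow> ('v, 'k::field) rep \<Rightarrow> bool" where
  "rep_le \<Omega> d V \<longleftrightarrow> representation \<Omega> V \<and> ell \<Omega> V \<le> d"

text \<open>
  The basic functors and the closure operations below preserve very faithfulness, so the rules do
  not demand it; a constructible functor is in addition to be \<open>very_faithful\<close>.
\<close>

inductive constructible ::
  "'v set \<Rightarrow> nat \<Rightarrow> variance \<Rightarrow> ('v, 'k::field) rep \<Rightarrow> ('v, 'k) rep \<Rightarrow>
   (('v, 'k) vec set \<Rightarrow> ('v, 'k) vec set) \<Rightarrow> bool"
  for \<Omega> d where
  const_empty: "rep_le \<Omega> d V \<Longrightarrow> rep_le \<Omega> d V' \<Longrightarrow> constructible \<Omega> d Covariant V V' (\<lambda>X. {})"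
| const_zero: "rep_le \<Omega> d V \<Longrightarrow> rep_le \<Omega> d V' \<Longrightarrow> constructible \<Omega> d Covariant V V' (\<lambda>X. {0})"
| const_space: "rep_le \<Omega> d V \<Longrightarrow> rep_le \<Omega> d V' \<Longrightarrow> constructible \<Omega> d Covariant V V' (\<lambda>X. vspace V')"
| const_scalar: "rep_le \<Omega> d V \<Longrightarrow>
    constructible \<Omega> d Covariant V (triv_rep \<Omega>) (\<lambda>X. {fscale c (basis_vec Unit)})"
| image: "rep_le \<Omega> d V \<Longrightarrow> rep_le \<Omega> d V' \<Longrightarrow> equivariant V V' f \<Longrightarrow>
    constructible \<Omega> d Covariant V V' (\<lambda>X. f ` X)"
| dual: "rep_le \<Omega> d V \<Longrightarrow>
    constructible \<Omega> d Contravariant V (dual_rep \<Omega> V)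
      (\<lambda>X. {f \<in> vspace (dual_rep \<Omega> V). \<forall>x\<in>X. pairing V f x = 1})"
| sum: "constructible \<Omega> d c V V' F' \<Longrightarrow> constructible \<Omega> d c V V'' F'' \<Longrightarrow>
    constructible \<Omega> d c V (sum_rep V' V'') (\<lambda>X. {sum_vec y y' | y y'. y \<in> F' X \<and> y' \<in> F'' X})"
| tensor: "constructible \<Omega> d c V V' F' \<Longrightarrow> constructible \<Omega> d c V V'' F'' \<Longrightarrow>
    ell \<Omega> V' + ell \<Omega> V'' \<le> d \<Longrightarrow>
    constructible \<Omega> d c V (tensor_rep V' V'')
      (\<lambda>X. affine_set hull {tensor_vec y y' | y y'. y \<in> F' X \<and> y' \<in> F'' X})"
| comp: "constructible \<Omega> d c V V' F \<Longrightarrow> constructible \<Omega> d c' V' V'' F' \<Longrightarrow>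
    constructible \<Omega> d (comp_variance c c') V V'' (\<lambda>X. F' (F X))"


section \<open>Cai-Fuerer-Immerman graphs\<close>

definition simple_graph :: "'x set \<Rightarrow> 'x set set \<Rightarrow> bool" where
  "simple_graph X E \<longleftrightarrow> finite X \<and> (\<forall>e\<in>E. e \<subseteq> X \<and> card e = 2)"

datatype 'x cfi_vertex = CV 'x "'x set set" | AV 'x "'x set" | BV 'x "'x set"

definition inc_edges :: "'x set set \<Rightarrow> 'x \<Rightarrow> 'x set set" where
  "inc_edges E x = {e \<in> E. x \<in> e}"

definition cfi_X1 :: "'x set \<Rightarrow> 'x set set \<Rightarrow> 'x cfi_vertex set" where
  "cfi_X1 X E = {CV x Y | x Y. x \<in> X \<and> Y \<subseteq> inc_edges E x \<and> even (card Y)}"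

definition cfi_X2 :: "'x set \<Rightarrow> 'x set set \<Rightarrow> 'x cfi_vertex set" where
  "cfi_X2 X E = {AV x e | x e. x \<in> X \<and> e \<in> inc_edges E x} \<union> {BV x e | x e. x \<in> X \<and> e \<in> inc_edges E x}"

definition cfi_X :: "'x set \<Rightarrow> 'x set set \<Rightarrow> 'x cfi_vertex set" where
  "cfi_X X E = cfi_X1 X E \<union> cfi_X2 X E"

definition cfi_edges :: "'x set \<Rightarrow> 'x set set \<Rightarrow> 'x cfi_vertex set set" where
  "cfi_edges X E =
     {{AV x e, CV x Y} | x e Y. CV x Y \<in> cfi_X1 X E \<and> e \<in> Y} \<union>
     {{BV x e, CV x Y} | x e Y. CV x Y \<in> cfi_X1 X E \<and> e \<in> inc_edges E x - Y} \<union>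
     {{AV x e, AV y e} | x y e. e \<in> E \<and> e = {x, y}} \<union>
     {{BV x e, BV y e} | x y e. e \<in> E \<and> e = {x, y}}"

definition cfi_edges' :: "'x set \<Rightarrow> 'x set set \<Rightarrow> 'x \<Rightarrow> 'x \<Rightarrow> 'x cfi_vertex set set" where
  "cfi_edges' X E x y =
     (let e = {x, y} in
       (cfi_edges X E - {{AV x e, AV y e}, {BV x e, BV y e}}) \<union> {{AV x e, BV y e}, {AV y e, BV x e}})"

definition colored_isomorphic :: "'u set \<Rightarrow> 'u set \<Rightarrow> 'u set set \<Rightarrow> 'u set set \<Rightarrow> bool" where
  "colored_isomorphic X\<^sub>1 X\<^sub>2 E E' \<longleftrightarrow>
     (\<exists>f. bij_betw f (X\<^sub>1 \<union> X\<^sub>2) (X\<^sub>1 \<union> X\<^sub>2) \<and> f ` X\<^sub>1 = X\<^sub>1 \<and> f ` X\<^sub>2 = X\<^sub>2 \<and>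
        (\<forall>u\<in>X\<^sub>1 \<union> X\<^sub>2. \<forall>v\<in>X\<^sub>1 \<union> X\<^sub>2. {u, v} \<in> E \<longleftrightarrow> {f u, f v} \<in> E'))"

definition graph_rep :: "'v set \<Rightarrow> ('v, 'k::field) rep" where
  "graph_rep \<Omega> =
     sum_rep (tensor_rep (perm_rep \<Omega>) (perm_rep \<Omega>))
       (sum_rep (perm_rep \<Omega>) (sum_rep (perm_rep \<Omega>) (triv_rep \<Omega>)))"

definition graph_vec :: "'v set \<Rightarrow> 'v set \<Rightarrow> 'v set set \<Rightarrow> ('v, 'k::field) vec" where
  "graph_vec X\<^sub>1 X\<^sub>2 E =
     sum_vec (\<Sum>(u, v)\<in>{(u, v). {u, v} \<in> E}. tensor_vec (basis_vec (Pt u)) (basis_vec (Pt v)))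
       (sum_vec (\<Sum>u\<in>X\<^sub>1. basis_vec (Pt u))
         (sum_vec (\<Sum>u\<in>X\<^sub>2. basis_vec (Pt u)) (basis_vec Unit)))"

end

theory Submission
  imports Defs
begin

text \<open>
  Let \<open>M\<close> be the adjacency matrix of one of the two graphs and \<open>D\<close> the diagonal matrix of the colour
  \<open>X\<^sub>1\<close>. The vectors \<open>(M y - y, D y)\<close>, \<open>y \<in> U\<close>, are the image of \<open>A \<otimes> U\<close> under an equivariant linear
  map \<open>V \<otimes> U \<rightarrow> U \<oplus> U\<close>, and \<open>V \<otimes> U\<close> has level 3; this is the functor. Its dimension at \<open>A\<close> is
  \<open>|X(Q)|\<close> minus that of the space of all \<open>z\<close> that are supported on \<open>X\<^sub>2\<close> and satisfy \<open>M z = z\<close>.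

  For such \<open>z\<close> the equations at the vertices \<open>c\<^sub>x\<^sub>,\<^sub>Y\<close> show that \<open>s = z(a\<^sub>x\<^sub>,\<^sub>e) + z(b\<^sub>x\<^sub>,\<^sub>e)\<close> does not depend
  on \<open>e\<close>, and the remaining ones that \<open>s\<close> is constant on the components of \<open>Q\<close>. In the twisted graph, the
  sum of the equations at \<open>c\<^sub>x\<^sub>,\<^sub>\<emptyset>\<close> over all \<open>x\<close> with \<open>s = 1\<close> is \<open>0 = s\<close> at the twisted edge, so that \<open>s = 0\<close>
  there and \<open>z\<close> is a solution for the untwisted graph as well. The indicator of the vertices \<open>a\<^sub>x\<^sub>,\<^sub>e\<close> is
  a solution for the untwisted graph only.

  A morphism between linear subspaces acts on the representation and maps the one into the other,
  hence isomorphic subspaces have the same dimension.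
\<close>

section \<open>Linear algebra in coordinates\<close>


lemma sum_fun_apply: "(\<Sum>i\<in>I. f i) x = (\<Sum>i\<in>I. f i x)"
  for f :: "'i \<Rightarrow> 'a \<Rightarrow> 'b::comm_monoid_add"
  by (induction I rule: infinite_finite_induct) auto

lemma subspace_vspace: "fvs.subspace (vspace V)"
  by (auto simp: fvs.subspace_def vspace_def fscale_def)

lemma basis_vec_in_vspace: "i \<in> labels V \<Longrightarrow> basis_vec i \<in> vspace V"
  by (auto simp: vspace_def basis_vec_def)

lemma vec_basis_expansion:
  assumes "finite (labels V)" "v \<in> vspace V"
  shows "v = (\<Sum>i\<in>labels V. fscale (v i) (basis_vec i))"
proof
  fix j
  have "(\<Sum>i\<in>labels V. fscale (v i) (basis_vec i)) j = (\<Sum>i\<in>labels V. if j = i then v i else 0)"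
    by (auto simp: sum_fun_apply fscale_def basis_vec_def intro!: sum.cong)
  also have "\<dots> = v j" using assms by (auto simp: vspace_def)
  finally show "v j = (\<Sum>i\<in>labels V. fscale (v i) (basis_vec i)) j" ..
qed

lemma linear_on_zero:
  assumes "linear_on S fscale fscale f" "fvs.subspace S"
  shows "f 0 = (0 :: 'j \<Rightarrow> 'k::field)"
proof -
  have "f (fscale 0 0) = fscale 0 (f 0)"
    using assms fvs.subspace_0 unfolding linear_on_def by blast
  then show ?thesis by simp
qed

lemma linear_on_vec_sum:
  fixes f :: "('i \<Rightarrow> 'k::field) \<Rightarrow> ('j \<Rightarrow> 'k)"
  assumes S: "fvs.subspace S" and lin: "linear_on S fscale fscale f"
    and I: "finite I" and a: "\<And>i. i \<in> I \<Longrightarrow> a i \<in> S"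
  shows "f (\<Sum>i\<in>I. fscale (c i) (a i)) = (\<Sum>i\<in>I. fscale (c i) (f (a i)))"
  using I a
proof (induction I rule: finite_induct)
  case empty
  then show ?case using linear_on_zero[OF lin S] by (simp add: zero_fun_def)
next
  case (insert x F)
  have "fscale (c x) (a x) \<in> S" "(\<Sum>i\<in>F. fscale (c i) (a i)) \<in> S" "a x \<in> S"
    using insert.prems by (auto intro!: fvs.subspace_scale fvs.subspace_sum S)
  then have "f (fscale (c x) (a x) + (\<Sum>i\<in>F. fscale (c i) (a i))) =
      fscale (c x) (f (a x)) + f (\<Sum>i\<in>F. fscale (c i) (a i))"
    using lin unfolding linear_on_def by metis
  then show ?case using insert by (simp only: sum.insert insert_iff simp_thms)
qed

lemma linear_on_coords:
  fixes f :: "('v, 'k::field) vec \<Rightarrow> ('j \<Rightarrow> 'k)"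
  assumes "finite (labels V)" "linear_on (vspace V) fscale fscale f" "v \<in> vspace V"
  shows "f v j = (\<Sum>i\<in>labels V. f (basis_vec i) j * v i)"
proof -
  have "f v = f (\<Sum>i\<in>labels V. fscale (v i) (basis_vec i))"
    using vec_basis_expansion assms by metis
  also have "\<dots> = (\<Sum>i\<in>labels V. fscale (v i) (f (basis_vec i)))"
    by (intro linear_on_vec_sum[OF subspace_vspace assms(2,1)]) (auto intro: basis_vec_in_vspace)
  finally show ?thesis by (simp add: sum_fun_apply fscale_def mult.commute)
qed

text \<open>An affine set v + Z through 0 has v = -z for some z in Z, so it equals Z. This is how
  the affine hull in the tensor rule for functors becomes a linear span.\<close>

lemma affine_hull_eq_span:
  assumes "0 \<in> S"
  shows "affine_set hull S = fvs.span S"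
proof (rule hull_unique)
  show "S \<subseteq> fvs.span S" by (rule fvs.span_superset)
  have "fvs.span S = (\<lambda>z. 0 + z) ` fvs.span S" by simp
  then show "affine_set (fvs.span S)" unfolding affine_set_def by blast
next
  fix T assume T: "S \<subseteq> T" "affine_set T"
  have 0: "0 \<in> T" using assms T(1) by blast
  then obtain v Z where vZ: "fvs.subspace Z" "T = (\<lambda>z. v + z) ` Z"
    using T(2) unfolding affine_set_def by blast
  with 0 obtain z where z: "z \<in> Z" "0 = v + z" by blast
  have "v = - z" using z(2)[symmetric] by (simp only: eq_neg_iff_add_eq_0)
  then have v: "v \<in> Z" using vZ(1) z(1) fvs.subspace_neg by blast
  have "t \<in> T" if "t \<in> Z" for t
  proof -
    have "t = v + (t - v)" by simp
    moreover have "t - v \<in> Z" using that v vZ(1) fvs.subspace_diff by blast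
    ultimately show ?thesis using vZ(2) by blast
  qed
  moreover have "t \<in> Z" if "t \<in> T" for t
    using that v vZ fvs.subspace_add by blast
  ultimately have "fvs.subspace T" using vZ(1) by (metis subsetI subset_antisym)
  then show "fvs.span S \<subseteq> T" using T(1) by (rule fvs.span_minimal[rotated])
qed

lemma subspace_imp_affine_set: "fvs.subspace S \<Longrightarrow> affine_set S"
  unfolding affine_set_def by (intro disjI2 exI[of _ 0] exI[of _ S]) simp

lemma direction_subspace:
  assumes "fvs.subspace S" shows "direction S = S"
proof
  show "direction S \<subseteq> S" using assms fvs.subspace_diff by (auto simp: direction_def)
  show "S \<subseteq> direction S"
  proof
    fix x assume "x \<in> S"
    moreover have "x = x - 0" "0 \<in> S" using assms fvs.subspace_0 by auto
    ultimately show "x \<in> direction S" unfolding direction_def by blast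
  qed
qed

section \<open>The filtration\<close>

lemma subspace_filtR: "fvs.subspace (filtR \<Omega> d)"
  by (cases d) (auto simp: subspace_prod_def)

lemma subspace_prodI: "s \<in> S \<Longrightarrow> t \<in> T \<Longrightarrow> s * t \<in> subspace_prod S T"
  unfolding subspace_prod_def by (rule fvs.span_base) blast

lemma subspace_coordR: "fvs.subspace (coordR \<Omega>)"
  by (auto simp: fvs.subspace_def coordR_def fscale_def)

text \<open>Being inside \<open>coordR\<close> makes \<open>unitR\<close> act as a unit on the whole
  filtration, although it is not the constant 1.\<close>

lemma filtR_subset_coordR: "(filtR \<Omega> d :: (('v \<Rightarrow> 'v) \<Rightarrow> 'k::field) set) \<subseteq> coordR \<Omega>"
proof (induction d)
  case 0
  have "fvs.span {unitR \<Omega>} \<subseteq> (coordR \<Omega> :: (_ \<Rightarrow> 'k) set)"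
    by (rule fvs.span_minimal) (auto simp: subspace_coordR, simp add: coordR_def unitR_def)
  then show ?case by simp
next
  case (Suc d)
  have "s * t \<in> coordR \<Omega>" if "s \<in> coordR \<Omega>" for s t :: "('v \<Rightarrow> 'v) \<Rightarrow> 'k"
    using that by (simp add: coordR_def)
  with Suc have "{s * t | s t. s \<in> filtR \<Omega> d \<and> t \<in> genW \<Omega>} \<subseteq> (coordR \<Omega> :: (_ \<Rightarrow> 'k) set)"
    by blast
  then show ?case
    by (simp add: subspace_prod_def fvs.span_minimal subspace_coordR)
qed

lemma mult_unitR: "r \<in> coordR \<Omega> \<Longrightarrow> r * unitR \<Omega> = r"
  by (auto simp: coordR_def unitR_def fun_eq_iff)

lemma unitR_in_genW: "unitR \<Omega> \<in> genW \<Omega>"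
  unfolding genW_def by (rule fvs.span_base) blast

lemma filtR_mono_Suc: "filtR \<Omega> d \<subseteq> filtR \<Omega> (Suc d)"
proof
  fix r :: "('a \<Rightarrow> 'a) \<Rightarrow> 'b" assume r: "r \<in> filtR \<Omega> d"
  then have "r * unitR \<Omega> = r" using filtR_subset_coordR mult_unitR by blast
  then show "r \<in> filtR \<Omega> (Suc d)"
    using subspace_prodI[OF r unitR_in_genW, of \<Omega>] by simp
qed

lemma filtR_mono: "d \<le> d' \<Longrightarrow> filtR \<Omega> d \<subseteq> filtR \<Omega> d'"
  using lift_Suc_mono_le[of "filtR \<Omega>"] filtR_mono_Suc by metis

lemma unitR_in_filtR: "unitR \<Omega> \<in> filtR \<Omega> d"
proof -
  have "unitR \<Omega> \<in> filtR \<Omega> 0" by (auto intro: fvs.span_base)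
  then show ?thesis using filtR_mono[of 0 d] by blast
qed

lemma mat_coeff_in_filtR:
  assumes "u \<in> \<Omega>" "v \<in> \<Omega>" "0 < d"
  shows "(mat_coeff \<Omega> u v :: _ \<Rightarrow> 'k::field) \<in> filtR \<Omega> d"
proof -
  have "(mat_coeff \<Omega> u v :: _ \<Rightarrow> 'k) \<in> genW \<Omega>"
    unfolding genW_def using assms by (intro fvs.span_base) blast
  from subspace_prodI[OF unitR_in_filtR[of _ 0] this]
  have "unitR \<Omega> * (mat_coeff \<Omega> u v :: _ \<Rightarrow> 'k) \<in> filtR \<Omega> (Suc 0)" by simp
  moreover have "unitR \<Omega> * (mat_coeff \<Omega> u v :: _ \<Rightarrow> 'k) = mat_coeff \<Omega> u v"
    by (auto simp: unitR_def mat_coeff_def fun_eq_iff)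
  ultimately show ?thesis using filtR_mono[of "Suc 0" d \<Omega>] assms by auto
qed

text \<open>The recursion of \<open>filtR\<close> splits off a last factor from W. Induction on
  \<open>q\<close> with \<open>s\<close> arbitrary, together with linearity in \<open>s\<close>,
  reduces to a product of some s' of degree q with some t in W, and (r * s') * t again has the
  recursive form.\<close>

lemma filtR_mult: "r \<in> filtR \<Omega> p \<Longrightarrow> s \<in> filtR \<Omega> q \<Longrightarrow> r * s \<in> filtR \<Omega> (p + q)"
proof (induction q arbitrary: s)
  case 0
  then obtain c where s: "s = fscale c (unitR \<Omega>)"
    by (auto simp: fvs.span_singleton)
  have "r * unitR \<Omega> = r" using 0 filtR_subset_coordR mult_unitR by blast
  then have "r * s = fscale c r" unfolding s
    by (auto simp: fscale_def fun_eq_iff ac_simps)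
  then show ?case using 0 fvs.subspace_scale[OF subspace_filtR] by auto
next
  case (Suc q)
  have "s \<in> fvs.span {s * t | s t. s \<in> filtR \<Omega> q \<and> t \<in> genW \<Omega>}"
    using Suc.prems(2) by (simp add: subspace_prod_def)
  then show ?case
  proof (induction rule: fvs.span_induct_alt)
    case base
    have "r * 0 = 0" by (simp add: fun_eq_iff)
    then show ?case using fvs.subspace_0[OF subspace_filtR] by metis
  next
    case (step c x y)
    then obtain s t where x: "x = s * t" "s \<in> filtR \<Omega> q" "t \<in> genW \<Omega>" by blast
    have "(r * s) * t \<in> filtR \<Omega> (Suc (p + q))"
      using subspace_prodI[OF Suc.IH[OF Suc.prems(1) x(2)] x(3)] by (simp only: filtR.simps)
    moreover have "r * y \<in> filtR \<Omega> (Suc (p + q))"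
      using step.IH by (simp only: times_fun_def add_Suc_right)
    ultimately have "fscale c ((r * s) * t) + r * y \<in> filtR \<Omega> (p + Suc q)"
      by (simp add: fvs.subspace_add fvs.subspace_scale subspace_filtR del: filtR.simps)
    moreover have "fscale c ((r * s) * t) + r * y = r * (fscale c x + y)"
      by (auto simp: x(1) fscale_def fun_eq_iff algebra_simps)
    ultimately show ?case by (simp add: times_fun_def plus_fun_def)
  qed
qed

text \<open>Closedness under \<open>trunc\<close> is exploited in this form: a relation of degree p
  may be multiplied by anything of degree d - p.\<close>

lemma mult_in_trunc:
  assumes "r \<in> J" "r \<in> filtR \<Omega> p" "s \<in> filtR \<Omega> q" "p + q = d"
  shows "r * s \<in> trunc \<Omega> d J"
proof -
  have "r * s \<in> subspace_prod (J \<inter> filtR \<Omega> p) (filtR \<Omega> (d - p))"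
    using assms by (intro subspace_prodI) auto
  then show ?thesis unfolding trunc_def using assms(4) by (intro fvs.span_base) auto
qed

section \<open>Representations that permute the labels\<close>

text \<open>\<open>map_label g\<close> renames every point inside a compound label, so U and the
  sums and tensor products built from it permute their labels, with (g v) j = v (g^-1 j). The
  representation axioms can then be verified once for the whole class. The formula is demanded for
  every \<open>v\<close>, also outside \<open>vspace V\<close>, so that it rewrites
  unconditionally.\<close>

definition label_permuting :: "'v set \<Rightarrow> ('v, 'k::field) rep \<Rightarrow> bool" where
  "label_permuting \<Omega> V \<longleftrightarrow>
     finite (labels V) \<and>
     (\<forall>g\<in>symgrp \<Omega>. \<forall>i\<in>labels V. map_label g i \<in> labels V) \<and>
     (\<forall>v j g. coact V v j g =
        (if j \<in> labels V \<and> g \<in> symgrp \<Omega> then v (map_label (inv g) j) else 0))"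

text \<open>An upper bound for \<open>ell\<close> in place of the least value: such bounds add under
  tensor products and pass to direct sums.\<close>

definition coact_level :: "'v set \<Rightarrow> nat \<Rightarrow> ('v, 'k::field) rep \<Rightarrow> bool" where
  "coact_level \<Omega> l V \<longleftrightarrow> (\<forall>v\<in>vspace V. coact V v \<in> tensor_space V (filtR \<Omega> l))"

lemma symgrp_inv: "g \<in> symgrp \<Omega> \<Longrightarrow> inv g \<in> symgrp \<Omega>"
  by (simp add: symgrp_def permutes_inv)

lemma symgrp_comp: "g \<in> symgrp \<Omega> \<Longrightarrow> h \<in> symgrp \<Omega> \<Longrightarrow> g \<circ> h \<in> symgrp \<Omega>"
  by (simp add: symgrp_def permutes_compose)

lemma id_symgrp: "id \<in> symgrp \<Omega>"
  by (simp add: symgrp_def permutes_id)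

lemma symgrp_inv_eq: "g \<in> symgrp \<Omega> \<Longrightarrow> g v = u \<longleftrightarrow> v = inv g u"
  by (auto simp: symgrp_def permutes_inverses)

lemma representation_label_permuting:
  assumes "label_permuting \<Omega> V"
  shows "representation \<Omega> V"
  unfolding representation_def
proof (intro conjI ballI)
  have co: "coact V v j g = (if j \<in> labels V \<and> g \<in> symgrp \<Omega> then v (map_label (inv g) j) else 0)"
    for v j g using assms by (simp add: label_permuting_def)
  have closed: "map_label (inv g) j \<in> labels V" if "g \<in> symgrp \<Omega>" "j \<in> labels V" for g j
    using assms that symgrp_inv by (auto simp: label_permuting_def)
  show fin: "finite (labels V)" using assms by (simp add: label_permuting_def)
  show "linear_on (vspace V) fscale (\<lambda>c t i. fscale c (t i)) (coact V)"
    by (auto simp: linear_on_def co fscale_def fun_eq_iff)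
  fix v assume v: "v \<in> vspace V"
  show "coact V v \<in> tensor_space V (coordR \<Omega>)"
    by (auto simp: tensor_space_def coordR_def co fun_eq_iff)
  show "(\<lambda>j. counit (coact V v j)) = v"
    using v by (auto simp: counit_def co id_symgrp label.map_id vspace_def fun_eq_iff)
  show "coact_tensor_id V (coact V v) = (\<lambda>j. comult \<Omega> (coact V v j))"
  proof (intro ext, clarify)
    fix j g h
    show "coact_tensor_id V (coact V v) j (g, h) = comult \<Omega> (coact V v j) (g, h)"
    proof (cases "j \<in> labels V \<and> g \<in> symgrp \<Omega> \<and> h \<in> symgrp \<Omega>")
      case True
      have "coact_tensor_id V (coact V v) j (g, h) =
          (\<Sum>i\<in>labels V. if map_label (inv g) j = i then v (map_label (inv h) i) else 0)"
        using True by (auto simp: coact_tensor_id_def co basis_vec_def intro!: sum.cong)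
      also have "\<dots> = v (map_label (inv h) (map_label (inv g) j))"
        using fin closed True by simp
      \<comment> \<open>Coassociativity amounts to (g o h)^-1 = h^-1 o g^-1.\<close>
      also have "\<dots> = v (map_label (inv (g \<circ> h)) j)"
        using True o_inv_distrib[of g h] permutes_bij[of g \<Omega>] permutes_bij[of h \<Omega>]
        by (simp add: label.map_comp symgrp_def)
      finally show ?thesis using True by (simp add: comult_def co symgrp_comp)
    next
      case False
      then show ?thesis by (auto simp: coact_tensor_id_def co comult_def)
    qed
  qed
qed

lemma ell_le: "coact_level \<Omega> l V \<Longrightarrow> ell \<Omega> V \<le> l"
  unfolding ell_def coact_level_def by (rule Least_le)

lemma coact_level_mono: "coact_level \<Omega> l V \<Longrightarrow> l \<le> l' \<Longrightarrow> coact_level \<Omega> l' V"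
  using filtR_mono[of l l' \<Omega>] by (auto simp: coact_level_def tensor_space_def)

lemma coact_level_basis:
  "coact_level \<Omega> l V \<Longrightarrow> i \<in> labels V \<Longrightarrow> j \<in> labels V \<Longrightarrow> coact V (basis_vec i) j \<in> filtR \<Omega> l"
  by (auto simp: coact_level_def tensor_space_def basis_vec_in_vspace)

lemma rep_leI: "label_permuting \<Omega> V \<Longrightarrow> coact_level \<Omega> l V \<Longrightarrow> l \<le> d \<Longrightarrow> rep_le \<Omega> d V"
  unfolding rep_le_def using representation_label_permuting ell_le order_trans by blast

text \<open>For \<open>g\<close> in the group, the entry of \<open>g\<close> at u, v is 1 exactly
  for v = g^-1 u, which leaves one term of the defining sum.\<close>

lemma label_permuting_perm_rep:
  assumes "finite \<Omega>"
  shows "label_permuting \<Omega> (perm_rep \<Omega> :: ('v, 'k::field) rep)"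
proof -
  have perm: "g u \<in> \<Omega> \<longleftrightarrow> u \<in> \<Omega>" if "g \<in> symgrp \<Omega>" for g u
    using that by (auto simp: symgrp_def permutes_in_image)
  have "(\<Sum>v\<in>\<Omega>. x (Pt v) * mat_coeff \<Omega> u v g) = (if g \<in> symgrp \<Omega> then x (Pt (inv g u)) else 0)"
    if "u \<in> \<Omega>" for x :: "('v, 'k) vec" and u g
  proof (cases "g \<in> symgrp \<Omega>")
    case True
    then have "(\<Sum>v\<in>\<Omega>. x (Pt v) * mat_coeff \<Omega> u v g) = (\<Sum>v\<in>\<Omega>. if v = inv g u then x (Pt v) else 0)"
      by (auto simp: mat_coeff_def symgrp_inv_eq intro!: sum.cong)
    also have "\<dots> = x (Pt (inv g u))"
      using that assms perm[OF symgrp_inv[OF True]] by simp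
    finally show ?thesis using True by simp
  qed (simp add: mat_coeff_def)
  then show ?thesis using assms perm
    by (auto simp: label_permuting_def perm_rep_def sum_fun_apply fscale_def split: label.splits)
qed

lemma coact_level_perm_rep: "coact_level \<Omega> 1 (perm_rep \<Omega>)"
  using mat_coeff_in_filtR[of _ \<Omega>]
  by (auto simp: coact_level_def tensor_space_def perm_rep_def image_iff simp del: filtR.simps
      intro!: fvs.subspace_sum[OF subspace_filtR] fvs.subspace_scale[OF subspace_filtR]
      split: label.splits)

lemma label_permuting_triv_rep: "label_permuting \<Omega> (triv_rep \<Omega>)"
  by (auto simp: label_permuting_def triv_rep_def fscale_def unitR_def)

lemma coact_level_triv_rep: "coact_level \<Omega> 0 (triv_rep \<Omega>)"
  using unitR_in_filtR[of \<Omega> 0]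
  by (auto simp: coact_level_def tensor_space_def triv_rep_def simp del: filtR.simps
      intro!: fvs.subspace_scale[OF subspace_filtR])

lemma label_permuting_sum_rep:
  "label_permuting \<Omega> V \<Longrightarrow> label_permuting \<Omega> W \<Longrightarrow> label_permuting \<Omega> (sum_rep V W)"
  by (auto simp: label_permuting_def sum_rep_def split: label.splits)

lemma coact_level_sum_rep:
  assumes "coact_level \<Omega> l V" "coact_level \<Omega> l W"
  shows "coact_level \<Omega> l (sum_rep V W)"
proof -
  have "(\<lambda>j. x (SumL j)) \<in> vspace V" "(\<lambda>j. x (SumR j)) \<in> vspace W" if "x \<in> vspace (sum_rep V W)" for x
    using that by (auto simp: vspace_def sum_rep_def)
  with assms show ?thesis
    unfolding coact_level_def tensor_space_def
    by (fastforce simp: sum_rep_def image_iff split: label.splits)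
qed

lemma labels_tensor_rep:
  "labels (tensor_rep V W) = (\<lambda>(i, j). Tens i j) ` (labels V \<times> labels W)"
  by (auto simp: tensor_rep_def)

lemma sum_labels_tensor_rep:
  "(\<Sum>l\<in>labels (tensor_rep V W). h l) = (\<Sum>i\<in>labels V. \<Sum>j\<in>labels W. h (Tens i j))"
proof -
  have "inj_on (\<lambda>(i, j). Tens i j) (labels V \<times> labels W)" by (auto simp: inj_on_def)
  then show ?thesis
    by (simp add: labels_tensor_rep sum.reindex sum.cartesian_product case_prod_unfold)
qed

lemma label_permuting_tensor_rep:
  assumes "label_permuting \<Omega> V" "label_permuting \<Omega> W"
  shows "label_permuting \<Omega> (tensor_rep V W)"
proof -
  have fin: "finite (labels V)" "finite (labels W)"
    using assms by (auto simp: label_permuting_def)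
  have closed: "map_label g i \<in> labels V" "map_label g j \<in> labels W"
    if "g \<in> symgrp \<Omega>" "i \<in> labels V" "j \<in> labels W" for g i j
    using assms that by (auto simp: label_permuting_def)
  have coV: "coact V v j g = (if j \<in> labels V \<and> g \<in> symgrp \<Omega> then v (map_label (inv g) j) else 0)"
    and coW: "coact W v j g = (if j \<in> labels W \<and> g \<in> symgrp \<Omega> then v (map_label (inv g) j) else 0)"
    for v j g using assms by (auto simp: label_permuting_def)
  have "(\<Sum>i\<in>labels V. \<Sum>j\<in>labels W.
          x (Tens i j) * (coact V (basis_vec i) i' g * coact W (basis_vec j) j' g)) =
        (if i' \<in> labels V \<and> j' \<in> labels W \<and> g \<in> symgrp \<Omega>
         then x (Tens (map_label (inv g) i') (map_label (inv g) j')) else 0)" for x i' j' g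
  proof (cases "i' \<in> labels V \<and> j' \<in> labels W \<and> g \<in> symgrp \<Omega>")
    case True
    have "(\<Sum>i\<in>labels V. \<Sum>j\<in>labels W.
          x (Tens i j) * (coact V (basis_vec i) i' g * coact W (basis_vec j) j' g)) =
        (\<Sum>i\<in>labels V. if map_label (inv g) i' = i then
           (\<Sum>j\<in>labels W. if map_label (inv g) j' = j then x (Tens i j) else 0) else 0)"
      using True by (auto simp: coV coW basis_vec_def intro!: sum.cong)
    also have "\<dots> = x (Tens (map_label (inv g) i') (map_label (inv g) j'))"
      using True fin closed[OF symgrp_inv, of g i' j'] by simp
    finally show ?thesis using True by simp
  qed (auto simp: coV coW)
  then show ?thesis
    using fin closed unfolding label_permuting_def labels_tensor_rep
    by (auto simp: tensor_rep_def sum_fun_apply fscale_def split: label.splits)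
qed

text \<open>The entries of the tensor coaction are combinations of products of one entry from each
  factor, so \<open>filtR_mult\<close> adds the levels.\<close>

lemma coact_level_tensor_rep:
  assumes V: "coact_level \<Omega> p V" and W: "coact_level \<Omega> q W"
  shows "coact_level \<Omega> (p + q) (tensor_rep V W)"
proof -
  have "coact V (basis_vec i) i' * coact W (basis_vec j) j' \<in> filtR \<Omega> (p + q)"
    if "i \<in> labels V" "i' \<in> labels V" "j \<in> labels W" "j' \<in> labels W" for i i' j j'
    using filtR_mult coact_level_basis V W that by blast
  moreover have "coact V (basis_vec i) i' * coact W (basis_vec j) j' = 0"
    if "i \<in> labels V" "j \<in> labels W" "i' \<notin> labels V \<or> j' \<notin> labels W" for i i' j j'
    using V W that basis_vec_in_vspace unfolding coact_level_def tensor_space_def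
    by (fastforce simp: fun_eq_iff)
  ultimately show ?thesis
    unfolding coact_level_def tensor_space_def
    by (auto simp: tensor_rep_def simp del: filtR.simps
        intro!: fvs.subspace_sum[OF subspace_filtR] fvs.subspace_scale[OF subspace_filtR]
          sum.neutral split: label.splits)
qed

lemma label_permuting_graph_rep: "finite \<Omega> \<Longrightarrow> label_permuting \<Omega> (graph_rep \<Omega>)"
  unfolding graph_rep_def
  by (intro label_permuting_sum_rep label_permuting_tensor_rep label_permuting_perm_rep
      label_permuting_triv_rep)

text \<open>The summand U \<otimes> U sets the level. One further tensor factor U then fits exactly
  into level 3.\<close>

lemma coact_level_graph_rep: "coact_level \<Omega> 2 (graph_rep \<Omega> :: ('v, 'k::field) rep)"
proof -
  have "coact_level \<Omega> 2 (tensor_rep (perm_rep \<Omega>) (perm_rep \<Omega>) :: ('v, 'k) rep)"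
    using coact_level_tensor_rep[OF coact_level_perm_rep coact_level_perm_rep] by (simp add: numeral_2_eq_2)
  moreover have "coact_level \<Omega> 2 (perm_rep \<Omega> :: ('v, 'k) rep)"
    "coact_level \<Omega> 2 (triv_rep \<Omega> :: ('v, 'k) rep)"
    by (rule coact_level_mono[OF coact_level_perm_rep] coact_level_mono[OF coact_level_triv_rep], simp)+
  ultimately show ?thesis
    unfolding graph_rep_def by (intro coact_level_sum_rep)
qed


section \<open>Coactions in coordinates and a pointwise test for equivariance\<close>

lemma representation_finite: "representation \<Omega> V \<Longrightarrow> finite (labels V)"
  by (simp add: representation_def)

lemma coact_outside:
  assumes "representation \<Omega> V" "v \<in> vspace V"
  shows "i \<notin> labels V \<Longrightarrow> coact V v i = 0" "g \<notin> symgrp \<Omega> \<Longrightarrow> coact V v i g = 0"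
  using assms by (auto simp: representation_def tensor_space_def coordR_def) (metis zero_fun_apply)

lemma coact_expansion:
  assumes "representation \<Omega> V" "v \<in> vspace V"
  shows "coact V v j g = (\<Sum>i\<in>labels V. coact V (basis_vec i) j g * v i)"
proof -
  have "linear_on (vspace V) fscale fscale (\<lambda>v j. coact V v j g)"
    using assms(1) by (auto simp: representation_def linear_on_def fun_eq_iff fscale_def)
  from linear_on_coords[OF representation_finite[OF assms(1)] this assms(2)] show ?thesis .
qed

text \<open>An element of V \<otimes> k[G] is determined by its values at the group elements, and
  evaluating at \<open>g\<close> turns \<open>map_tensor_id V f\<close> into \<open>f\<close>
  applied to the vector of values. Outside the group both sides are 0.\<close>

lemma equivariantI:
  assumes V: "representation \<Omega> V" and V': "representation \<Omega> V'"
    and maps: "f ` vspace V \<subseteq> vspace V'" and lin: "linear_on (vspace V) fscale fscale f"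
    and comm: "\<And>v g. v \<in> vspace V \<Longrightarrow> g \<in> symgrp \<Omega> \<Longrightarrow>
      (\<lambda>j. coact V' (f v) j g) = f (\<lambda>i. coact V v i g)"
  shows "equivariant V V' f"
  unfolding equivariant_def
proof (intro conjI maps lin ballI ext)
  fix v j g assume v: "v \<in> vspace V"
  have "(\<lambda>i. coact V v i g) \<in> vspace V"
    using coact_outside(1)[OF V v] by (auto simp: vspace_def)
  from linear_on_coords[OF representation_finite[OF V] lin this]
  have "map_tensor_id V f (coact V v) j g = f (\<lambda>i. coact V v i g) j"
    by (simp add: map_tensor_id_def)
  also have "\<dots> = coact V' (f v) j g"
  proof (cases "g \<in> symgrp \<Omega>")
    case True
    then show ?thesis using comm[OF v True] by (metis)
  next
    case False
    have "(\<lambda>i. coact V v i g) = 0" using coact_outside(2)[OF V v False] by (simp add: fun_eq_iff)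
    moreover have "f v \<in> vspace V'" using maps v by blast
    ultimately show ?thesis
      using linear_on_zero[OF lin subspace_vspace] coact_outside(2)[OF V' _ False] by simp
  qed
  finally show "coact V' (f v) j g = map_tensor_id V f (coact V v) j g" ..
qed

lemma subspace_linear_on_image:
  assumes lin: "linear_on A fscale fscale f" and S: "fvs.subspace S" "S \<subseteq> A"
  shows "fvs.subspace (f ` S)"
proof (unfold fvs.subspace_def, intro conjI ballI allI)
  have "linear_on S fscale fscale f" using lin S(2) unfolding linear_on_def by blast
  then show "0 \<in> f ` S"
    using linear_on_zero S(1) fvs.subspace_0[OF S(1)] by (metis imageI)
  fix x assume "x \<in> f ` S"
  then obtain a where a: "x = f a" "a \<in> S" by blast
  show "fscale c x \<in> f ` S" for c
    using a lin S fvs.subspace_scale[OF S(1)] unfolding linear_on_def by (metis imageI subsetD)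
  fix y assume "y \<in> f ` S"
  then obtain b where b: "y = f b" "b \<in> S" by blast
  show "x + y \<in> f ` S"
    using a b lin S fvs.subspace_add[OF S(1)] unfolding linear_on_def by (metis imageI subsetD)
qed

section \<open>Tensor products with a fixed representation\<close>

lemma tensor_vec_in_vspace:
  "x \<in> vspace V \<Longrightarrow> y \<in> vspace W \<Longrightarrow> tensor_vec x y \<in> vspace (tensor_rep V W)"
  by (auto simp: vspace_def tensor_vec_def tensor_rep_def split: label.splits)

lemma linear_on_tensor_vec: "linear_on A fscale fscale (tensor_vec x)"
  by (auto simp: linear_on_def tensor_vec_def fscale_def fun_eq_iff algebra_simps split: label.splits)

text \<open>Expanding both coactions over the basis turns the product of the two sums into the
  double sum that defines the tensor coaction.\<close>

lemma coact_tensor_vec: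
  assumes V: "representation \<Omega> V" "x \<in> vspace V" and W: "representation \<Omega> W" "y \<in> vspace W"
  shows "coact (tensor_rep V W) (tensor_vec x y) (Tens i j) g = coact V x i g * coact W y j g"
  unfolding coact_expansion[OF V] coact_expansion[OF W] sum_product
  by (simp add: tensor_rep_def sum_fun_apply fscale_def tensor_vec_def ac_simps)

lemma pairing_diff: "pairing V f (x - y) = pairing V f x - pairing V f y"
  by (simp add: pairing_def algebra_simps sum_subtractf)

text \<open>
  The functional \<open>\<psi>\<^sub>b = \<phi> (f (_ \<otimes> e\<^sub>b))\<close> vanishes on \<open>Y\<close>, so the relation \<open>r\<^sub>b\<close> that it yields lies in
  \<open>J \<inter> R\<^sub>p\<close>; and \<open>g \<mapsto> \<phi> (f (g x \<otimes> g y))\<close> is the sum of all \<open>r\<^sub>b (g y)\<^sub>b\<close>.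
\<close>

lemma pairing_tensor_image_in_ideal:
  assumes V: "representation \<Omega> V" and W: "representation \<Omega> W"
    and lV: "coact_level \<Omega> p V" and lW: "coact_level \<Omega> q W" and pq: "p + q = d"
    and f: "equivariant (tensor_rep V W) V' f"
    and J: "fvs.subspace J" "trunc \<Omega> d J = J" "relS \<Omega> V X Y \<subseteq> J"
    and XY: "X \<subseteq> vspace V" "Y \<subseteq> vspace V" and xy: "x \<in> X" "y \<in> vspace W" and Y: "Y \<noteq> {}"
    and \<phi>: "\<And>x' y'. x' \<in> Y \<Longrightarrow> y' \<in> vspace W \<Longrightarrow> pairing V' \<phi> (f (tensor_vec x' y')) = 0"
  shows "pairing_tensor_id V' \<phi> (coact V' (f (tensor_vec x y))) \<in> J"
proof -
  \<comment> \<open>Cutting off outside the labels puts \<open>\<psi> b\<close> into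
    \<open>vspace V\<close>, as the generators of \<open>relS\<close> demand.\<close>
  define \<psi> where "\<psi> b a = (if a \<in> labels V then pairing V' \<phi> (f (basis_vec (Tens a b))) else 0)" for a b
  define r where "r b = pairing_tensor_id V (\<psi> b) (coact V x)" for b
  have fin: "finite (labels V)" "finite (labels W)" "finite (labels (tensor_rep V W))"
    using V W by (auto simp: representation_finite labels_tensor_rep)
  have lin: "linear_on (vspace (tensor_rep V W)) fscale fscale f"
    using f by (simp add: equivariant_def)
  have xV: "x \<in> vspace V" using xy XY by blast
  have \<psi>_pairing: "pairing V (\<psi> b) v = pairing V' \<phi> (f (tensor_vec v (basis_vec b)))"
    if "v \<in> vspace V" "b \<in> labels W" for v b
  proof -
    have "f (tensor_vec v (basis_vec b)) j = (\<Sum>a\<in>labels V. f (basis_vec (Tens a b)) j * v a)" for j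
    proof -
      have "f (tensor_vec v (basis_vec b)) j =
          (\<Sum>a\<in>labels V. \<Sum>c\<in>labels W. f (basis_vec (Tens a c)) j * (v a * basis_vec b c))"
        using linear_on_coords[OF fin(3) lin tensor_vec_in_vspace[OF that(1) basis_vec_in_vspace[OF that(2)]]]
        by (simp add: sum_labels_tensor_rep tensor_vec_def)
      also have "\<dots> = (\<Sum>a\<in>labels V. \<Sum>c\<in>labels W. if c = b then f (basis_vec (Tens a b)) j * v a else 0)"
        by (auto simp: basis_vec_def intro!: sum.cong)
      finally show ?thesis using fin that by simp
    qed
    then show ?thesis
      by (simp add: pairing_def \<psi>_def sum_distrib_left sum_distrib_right mult.assoc
          sum.swap[of _ "labels V" "labels V'"])
  qed
  \<comment> \<open>\<open>\<psi> b\<close> vanishes on all of Y, hence along its direction and also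
    at the base point. The constant term of the relation is therefore 0 and the generator is
    \<open>r b\<close> itself.\<close>
  have rJ: "r b \<in> J" if b: "b \<in> labels W" for b
  proof -
    have zero: "pairing V (\<psi> b) v = 0" if "v \<in> Y" for v
      using \<psi>_pairing[OF _ b] \<phi>[OF that] XY that basis_vec_in_vspace[OF b] by auto
    obtain v where v: "v \<in> Y" using Y by blast
    have "\<psi> b \<in> vspace V" by (auto simp: vspace_def \<psi>_def)
    moreover have "\<forall>z\<in>direction Y. pairing V (\<psi> b) z = 0"
      using zero by (auto simp: direction_def pairing_diff)
    ultimately have "pairing_tensor_id V (\<psi> b) (coact V x) - fscale (pairing V (\<psi> b) v) (unitR \<Omega>)
        \<in> relS \<Omega> V X Y"
      using xy Y v unfolding relS_def by (auto intro!: fvs.span_base)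
    then show ?thesis using J(3) zero[OF v] by (auto simp: r_def)
  qed
  have rR: "r b \<in> filtR \<Omega> p" for b
    using lV xV unfolding r_def pairing_tensor_id_def coact_level_def tensor_space_def
    by (auto intro!: fvs.subspace_sum[OF subspace_filtR] fvs.subspace_scale[OF subspace_filtR])
  have yR: "coact W y b \<in> filtR \<Omega> q" if "b \<in> labels W" for b
    using lW xy that unfolding coact_level_def tensor_space_def by auto
  have "pairing_tensor_id V' \<phi> (coact V' (f (tensor_vec x y))) = (\<Sum>b\<in>labels W. r b * coact W y b)"
  proof
    fix g
    have "coact V' (f (tensor_vec x y)) j g =
        (\<Sum>a\<in>labels V. \<Sum>b\<in>labels W. f (basis_vec (Tens a b)) j * (coact V x a g * coact W y b g))" for j
      using f tensor_vec_in_vspace[OF xV xy(2)]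
      by (simp add: equivariant_def map_tensor_id_def sum_labels_tensor_rep
          coact_tensor_vec[OF V xV W xy(2)])
    then have "pairing_tensor_id V' \<phi> (coact V' (f (tensor_vec x y))) g =
        (\<Sum>j\<in>labels V'. \<Sum>a\<in>labels V. \<Sum>b\<in>labels W.
           \<phi> j * f (basis_vec (Tens a b)) j * (coact V x a g * coact W y b g))"
      by (simp add: pairing_tensor_id_def sum_fun_apply fscale_def sum_distrib_left mult.assoc)
    also have "\<dots> = (\<Sum>a\<in>labels V. \<Sum>b\<in>labels W. \<Sum>j\<in>labels V'.
           \<phi> j * f (basis_vec (Tens a b)) j * (coact V x a g * coact W y b g))"
      by (simp add: sum.swap[of _ _ "labels V'"])
    also have "\<dots> = (\<Sum>b\<in>labels W. \<Sum>a\<in>labels V. \<Sum>j\<in>labels V'.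
           \<phi> j * f (basis_vec (Tens a b)) j * (coact V x a g * coact W y b g))"
      by (rule sum.swap)
    also have "\<dots> = (\<Sum>b\<in>labels W. r b * coact W y b) g"
      by (simp add: r_def \<psi>_def pairing_def pairing_tensor_id_def sum_fun_apply fscale_def
          sum_distrib_right mult.assoc)
    finally show "pairing_tensor_id V' \<phi> (coact V' (f (tensor_vec x y))) g =
      (\<Sum>b\<in>labels W. r b * coact W y b) g" .
  qed
  also have "\<dots> \<in> J"
    using mult_in_trunc[OF rJ rR yR pq] J(2) by (auto intro!: fvs.subspace_sum[OF J(1)])
  finally show ?thesis .
qed

section \<open>Functoriality of tensoring with a whole representation\<close>

text \<open>Each truncated ideal is the intersection of the closed subspaces above its generators,
  so containment can be tested on one closed \<open>J\<close> at a time. Smaller ideals mean larger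
  morphism spaces.\<close>

lemma trunc_ideal_subset:
  assumes "\<And>J. fvs.subspace J \<Longrightarrow> trunc \<Omega> d J = J \<Longrightarrow> S \<subseteq> J \<Longrightarrow> S' \<subseteq> J"
  shows "trunc_ideal \<Omega> d S' \<subseteq> trunc_ideal \<Omega> d S"
  using assms unfolding trunc_ideal_def hull_def by blast

text \<open>The functor X \<mapsto> X \<otimes> W with constant second factor, followed by the image
  under \<open>f\<close>. Since all of W is used, equivariant \<open>f\<close> gives linear
  subspaces, not merely affine ones, at nonempty X.\<close>

definition tensor_image ::
  "('v, 'k::field) rep \<Rightarrow> (('v, 'k) vec \<Rightarrow> ('v, 'k) vec) \<Rightarrow> ('v, 'k) vec set \<Rightarrow> ('v, 'k) vec set" where
  "tensor_image W f X = f ` (affine_set hull {tensor_vec x y | x y. x \<in> X \<and> y \<in> vspace W})"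

lemma tensor_image_empty: "tensor_image W f {} = {}"
  by (simp add: tensor_image_def hull_same affine_set_def)

lemma tensor_image_nonempty:
  assumes "X \<noteq> {}"
  shows "tensor_image W f X = f ` fvs.span {tensor_vec x y | x y. x \<in> X \<and> y \<in> vspace W}"
proof -
  obtain x where "x \<in> X" using assms by blast
  moreover have "tensor_vec x 0 = 0" by (auto simp: tensor_vec_def fun_eq_iff split: label.splits)
  ultimately have "0 \<in> {tensor_vec x y | x y. x \<in> X \<and> y \<in> vspace W}"
    using fvs.subspace_0[OF subspace_vspace] by (smt (verit, best) mem_Collect_eq)
  then show ?thesis by (simp add: tensor_image_def affine_hull_eq_span)
qed

lemma span_tensor_vec_subset:
  "X \<subseteq> vspace V \<Longrightarrow>
   fvs.span {tensor_vec x y | x y. x \<in> X \<and> y \<in> vspace W} \<subseteq> vspace (tensor_rep V W)"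
  by (rule fvs.span_minimal[OF _ subspace_vspace]) (auto intro: tensor_vec_in_vspace)

lemma subspace_tensor_image:
  assumes "equivariant (tensor_rep V W) V' f" "X \<subseteq> vspace V" "X \<noteq> {}"
  shows "fvs.subspace (tensor_image W f X)" "tensor_image W f X \<subseteq> vspace V'"
proof -
  have "linear_on (vspace (tensor_rep V W)) fscale fscale f"
    "f ` vspace (tensor_rep V W) \<subseteq> vspace V'"
    using assms(1) by (auto simp: equivariant_def)
  with span_tensor_vec_subset[OF assms(2), of W]
  show "fvs.subspace (tensor_image W f X)" "tensor_image W f X \<subseteq> vspace V'"
    unfolding tensor_image_nonempty[OF assms(3)]
    by (auto intro: subspace_linear_on_image)
qed

text \<open>At nonempty sets the values are linear subspaces, so a functional that vanishes along
  the direction of the image of Y vanishes on that image, and the constant term of each relation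
  disappears. What remains is linear in \<open>w\<close> and is checked on pure tensors by
  \<open>pairing_tensor_image_in_ideal\<close>.\<close>

lemma relS_tensor_image_subset:
  assumes V: "representation \<Omega> V" and W: "representation \<Omega> W" and V': "representation \<Omega> V'"
    and lV: "coact_level \<Omega> p V" and lW: "coact_level \<Omega> q W" and pq: "p + q = d"
    and f: "equivariant (tensor_rep V W) V' f"
    and J: "fvs.subspace J" "trunc \<Omega> d J = J" "relS \<Omega> V X Y \<subseteq> J"
    and XY: "X \<subseteq> vspace V" "Y \<subseteq> vspace V"
  shows "relS \<Omega> V' (tensor_image W f X) (tensor_image W f Y) \<subseteq> J"
proof (cases "X = {} \<or> Y = {}")
  case True
  show ?thesis
  proof (cases "X = {}")
    case True
    then show ?thesis using fvs.subspace_0[OF J(1)] by (simp add: relS_def tensor_image_empty)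
  next
    case False
    then have "tensor_image W f X \<noteq> {}"
      using subspace_tensor_image(1)[OF f XY(1)] fvs.subspace_0 by blast
    \<comment> \<open>X is nonempty and Y is empty: both relation spaces are spanned by the
      unit.\<close>
    then show ?thesis using True False J(3) by (simp add: relS_def tensor_image_empty)
  qed
next
  case False
  let ?SX = "fvs.span {tensor_vec x y | x y. x \<in> X \<and> y \<in> vspace W}"
  have subY: "fvs.subspace (tensor_image W f Y)"
    using subspace_tensor_image(1)[OF f XY(2)] False by blast
  have ne: "tensor_image W f X \<noteq> {}" "tensor_image W f Y \<noteq> {}"
    using subspace_tensor_image(1)[OF f] XY False fvs.subspace_0 by blast+
  have "pairing_tensor_id V' \<phi> (coact V' w) - fscale (pairing V' \<phi> v) (unitR \<Omega>) \<in> J"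
    if \<phi>: "\<forall>z\<in>direction (tensor_image W f Y). pairing V' \<phi> z = 0"
      and w: "w \<in> tensor_image W f X" and v: "v \<in> tensor_image W f Y" for \<phi> w v
  proof -
    have zero: "pairing V' \<phi> z = 0" if "z \<in> tensor_image W f Y" for z
      using \<phi> that direction_subspace[OF subY] by blast
    have zero': "pairing V' \<phi> (f (tensor_vec x y)) = 0" if "x \<in> Y" "y \<in> vspace W" for x y
      using that tensor_image_nonempty[of Y W f] False by (intro zero) (auto intro!: fvs.span_base)
    have lin: "linear_on (vspace (tensor_rep V W)) fscale fscale f"
      and maps: "f ` vspace (tensor_rep V W) \<subseteq> vspace V'"
      using f by (auto simp: equivariant_def)
    have co_add: "coact V' (u + u') j = coact V' u j + coact V' u' j"
      and co_scale: "coact V' (fscale c u) j = fscale c (coact V' u j)"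
      if "u \<in> vspace V'" "u' \<in> vspace V'" for u u' c j
      using V' that by (auto simp: representation_def linear_on_def)
    obtain t where t: "t \<in> ?SX" "w = f t"
      using w tensor_image_nonempty[of X W f] False by blast
    \<comment> \<open>\<open>f\<close> is linear only on the tensor space, so membership in that
      space is carried through the induction.\<close>
    from t(1) have "t \<in> vspace (tensor_rep V W) \<and> pairing_tensor_id V' \<phi> (coact V' (f t)) \<in> J"
    proof (induction rule: fvs.span_induct_alt)
      case base
      have "f 0 = 0" by (rule linear_on_zero[OF lin subspace_vspace])
      moreover have "coact V' 0 j = 0" for j
        using co_scale[of 0 0 0] fvs.subspace_0[OF subspace_vspace, of V'] by simp
      ultimately have "pairing_tensor_id V' \<phi> (coact V' (f 0)) = 0"
        by (simp add: pairing_tensor_id_def)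
      then show ?case using fvs.subspace_0[OF J(1)] fvs.subspace_0[OF subspace_vspace] by metis
    next
      case (step c t s)
      then obtain x y where xy: "t = tensor_vec x y" "x \<in> X" "y \<in> vspace W" by blast
      have tV: "t \<in> vspace (tensor_rep V W)"
        using xy XY(1) by (auto intro: tensor_vec_in_vspace)
      have tJ: "pairing_tensor_id V' \<phi> (coact V' (f t)) \<in> J"
        unfolding xy(1)
        using pairing_tensor_image_in_ideal[OF V W lV lW pq f J XY xy(2,3) _ zero'] False by blast
      have "f (fscale c t + s) = fscale c (f t) + f s"
        using lin tV step.IH fvs.subspace_scale[OF subspace_vspace] unfolding linear_on_def by metis
      moreover have "f t \<in> vspace V'" "f s \<in> vspace V'" "fscale c (f t) \<in> vspace V'"
        using maps tV step.IH fvs.subspace_scale[OF subspace_vspace] by blast+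
      ultimately have "pairing_tensor_id V' \<phi> (coact V' (f (fscale c t + s))) =
          fscale c (pairing_tensor_id V' \<phi> (coact V' (f t))) + pairing_tensor_id V' \<phi> (coact V' (f s))"
        by (simp add: pairing_tensor_id_def co_add co_scale fvs.scale_right_distrib sum.distrib
            fvs.scale_sum_right mult.commute)
      then have "pairing_tensor_id V' \<phi> (coact V' (f (fscale c t + s))) \<in> J"
        using tJ step.IH by (simp add: fvs.subspace_add fvs.subspace_scale J(1))
      moreover have "fscale c t + s \<in> vspace (tensor_rep V W)"
        using tV step.IH by (simp add: fvs.subspace_add fvs.subspace_scale subspace_vspace)
      ultimately show ?case by (simp add: plus_fun_def)
    qed
    then show ?thesis using zero[OF v] t(2) by simp
  qed
  then show ?thesis
    unfolding relS_def if_not_P[OF ne(1)] if_not_P[OF ne(2)]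
    by (intro fvs.span_minimal[OF _ J(1)]) blast
qed

text \<open>Identities and composition are formed from functionals on R_d and mention neither the
  objects nor the representation, so they are preserved automatically. What has to be proved is that
  morphism spaces are contained in one another, which follows from the reverse containment of the
  ideals.\<close>

lemma very_faithful_tensor_image:
  assumes V: "representation \<Omega> V" and W: "representation \<Omega> W" and V': "representation \<Omega> V'"
    and "coact_level \<Omega> p V" "coact_level \<Omega> q W" "p + q = d"
    and f: "equivariant (tensor_rep V W) V' f"
  shows "very_faithful \<Omega> d Covariant V V' (tensor_image W f)"
proof -
  have "tensor_image W f X \<subseteq> vspace V' \<and> affine_set (tensor_image W f X)" if "X \<subseteq> vspace V" for X
    using subspace_tensor_image[OF f that] subspace_imp_affine_set
    by (cases "X = {}") (auto simp: tensor_image_empty affine_set_def)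
  moreover have "trunc_ideal \<Omega> d (relS \<Omega> V' (tensor_image W f X) (tensor_image W f Y)) \<subseteq>
      trunc_ideal \<Omega> d (relS \<Omega> V X Y)" if "X \<subseteq> vspace V" "Y \<subseteq> vspace V" for X Y
    using relS_tensor_image_subset[OF assms _ _ _ that] by (intro trunc_ideal_subset) blast
  ultimately show ?thesis
    unfolding very_faithful.simps is_functor_def approx_cat_def by simp blast
qed

section \<open>Isomorphic subspaces\<close>

text \<open>Extend a basis of \<open>S\<close> by \<open>v\<close> and let \<open>h\<close> be 1 at
  \<open>v\<close> and 0 on the basis. The coordinates of \<open>f\<close> are the values of
  \<open>h\<close> on basis vectors, so the pairing reproduces \<open>h\<close> on
  \<open>vspace V\<close>.\<close>

lemma separating_functional:
  fixes V :: "('v, 'k::field) rep"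
  assumes fin: "finite (labels V)" and S: "fvs.subspace S"
    and v: "v \<in> vspace V" "v \<notin> S"
  obtains f where "f \<in> vspace V" "\<And>s. s \<in> S \<Longrightarrow> s \<in> vspace V \<Longrightarrow> pairing V f s = 0" "pairing V f v \<noteq> 0"
proof -
  interpret P: vector_space_pair "fscale :: 'k \<Rightarrow> ('v, 'k) vec \<Rightarrow> ('v, 'k) vec" "(*) :: 'k \<Rightarrow> 'k \<Rightarrow> 'k"
    by unfold_locales (auto simp: algebra_simps)
  obtain B where B: "B \<subseteq> S" "fvs.independent B" "S \<subseteq> fvs.span B"
    using fvs.basis_exists by metis
  have "fvs.span B \<subseteq> S" using fvs.span_minimal[OF B(1) S] .
  then have vB: "v \<notin> fvs.span B" "v \<notin> B" using v B(1) by auto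
  then have "fvs.independent (insert v B)"
    using B(2) by (intro fvs.independent_insertI)
  from P.linear_independent_extend[OF this, of "\<lambda>x. if x = v then 1 else 0"]
  obtain h where lin: "Vector_Spaces.linear fscale (*) h" and "\<forall>x\<in>insert v B. h x = (if x = v then 1 else 0)"
    by blast
  then have h: "h v = 1" "\<And>b. b \<in> B \<Longrightarrow> h b = 0" using vB(2) by auto
  interpret L: Vector_Spaces.linear "fscale :: 'k \<Rightarrow> ('v, 'k) vec \<Rightarrow> ('v, 'k) vec" "(*) :: 'k \<Rightarrow> 'k \<Rightarrow> 'k" h
    by (rule lin)
  have hS: "h s = 0" if "s \<in> S" for s
    using L.eq_0_on_span[of B s] h(2) that B(3) by blast
  define f where "f i = (if i \<in> labels V then h (basis_vec i) else 0)" for i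
  have pair: "pairing V f w = h w" if "w \<in> vspace V" for w
  proof -
    have "h w = h (\<Sum>i\<in>labels V. fscale (w i) (basis_vec i))"
      using vec_basis_expansion[OF fin that] by metis
    then show ?thesis by (simp add: L.sum L.scale pairing_def f_def mult.commute)
  qed
  show ?thesis
  proof
    show "f \<in> vspace V" by (simp add: f_def vspace_def)
  qed (use pair hS h(1) v in auto)
qed

lemma dual_filtR_zero: "\<phi> \<in> dual_filtR \<Omega> d \<Longrightarrow> \<phi> 0 = 0"
proof -
  assume "\<phi> \<in> dual_filtR \<Omega> d"
  then have "\<phi> (fscale 0 0) = 0 * \<phi> 0"
    using fvs.subspace_0[OF subspace_filtR] unfolding dual_filtR_def linear_on_def by blast
  then show "\<phi> 0 = 0" by simp
qed

text \<open>A morphism acts by (id \<otimes> \<phi>) \<mu>, because the level bound places the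
  coefficients of the coaction in R_d. If the image of v were outside T, a functional f that is 0 on
  T and nonzero at this image would yield the relation (f \<otimes> id) \<mu>(v), which \<phi>
  kills; but \<phi> sends it to the value of f at the image.\<close>

lemma hom_acts_on_subspace:
  assumes V: "representation \<Omega> V" and lV: "coact_level \<Omega> d V"
    and ST: "fvs.subspace S" "S \<subseteq> vspace V" "fvs.subspace T" and TV: "T \<subseteq> vspace V"
    and \<phi>: "\<phi> \<in> Hom (approx_cat \<Omega> d V) S T" and v: "v \<in> S"
  shows "(\<lambda>i. \<phi> (coact V v i)) \<in> T"
proof (rule ccontr)
  assume neg: "(\<lambda>i. \<phi> (coact V v i)) \<notin> T"
  have \<phi>d: "\<phi> \<in> dual_filtR \<Omega> d"
    and \<phi>0: "\<And>r. r \<in> trunc_ideal \<Omega> d (relS \<Omega> V S T) \<Longrightarrow> \<phi> r = 0"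
    using \<phi> by (auto simp: approx_cat_def)
  have vV: "v \<in> vspace V" using v ST by blast
  have "(\<lambda>i. \<phi> (coact V v i)) \<in> vspace V"
    using coact_outside(1)[OF V vV] dual_filtR_zero[OF \<phi>d] by (auto simp: vspace_def)
  from separating_functional[OF representation_finite[OF V] ST(3) this neg]
  obtain f where f: "f \<in> vspace V" "\<And>s. s \<in> T \<Longrightarrow> s \<in> vspace V \<Longrightarrow> pairing V f s = 0"
    "pairing V f (\<lambda>i. \<phi> (coact V v i)) \<noteq> 0" by metis
  define r where "r = pairing_tensor_id V f (coact V v)"
  have 0: "0 \<in> T" "pairing V f 0 = 0"
    using fvs.subspace_0[OF ST(3)] by (auto simp: pairing_def)
  \<comment> \<open>With base point 0 of T the constant term vanishes, so this generator is
    \<open>r\<close>.\<close>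
  have "r - fscale (pairing V f 0) (unitR \<Omega>) \<in> relS \<Omega> V S T"
  proof -
    have "\<forall>z\<in>direction T. pairing V f z = 0" using f(2) TV direction_subspace[OF ST(3)] by blast
    moreover have "S \<noteq> {}" "T \<noteq> {}" using v 0(1) by auto
    ultimately show ?thesis
      using f(1) v 0(1) unfolding relS_def r_def by (simp, intro fvs.span_base, blast)
  qed
  then have "r \<in> trunc_ideal \<Omega> d (relS \<Omega> V S T)"
    using 0(2) hull_subset unfolding trunc_ideal_def by fastforce
  then have "\<phi> r = 0" by (rule \<phi>0)
  moreover have "\<phi> r = pairing V f (\<lambda>i. \<phi> (coact V v i))"
    using linear_on_sum[OF subspace_filtR _ representation_finite[OF V], of \<Omega> d \<phi> "coact V v" f]
      \<phi>d lV vV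
    by (auto simp: r_def pairing_tensor_id_def pairing_def dual_filtR_def coact_level_def tensor_space_def)
  ultimately show False using f(3) by simp
qed

text \<open>Coassociativity turns the product of functionals defined by \<open>comult\<close> into
  the composite of their actions, and the counit acts as the identity.\<close>

lemma comp_eq_id_acts:
  assumes V: "representation \<Omega> V" and lV: "coact_level \<Omega> d V"
    and \<phi>: "\<phi> \<in> dual_filtR \<Omega> d" and \<psi>: "\<psi> \<in> dual_filtR \<Omega> d"
    and comp: "Comp (approx_cat \<Omega> d V) \<psi> \<phi> = Id (approx_cat \<Omega> d V) X"
    and v: "v \<in> vspace V"
  shows "(\<lambda>i. \<psi> (coact V (\<lambda>j. \<phi> (coact V v j)) i)) = v"
proof
  fix i
  let ?w = "\<lambda>j. \<phi> (coact V v j)"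
  have w: "?w \<in> vspace V"
    using coact_outside(1)[OF V v] dual_filtR_zero[OF \<phi>] by (auto simp: vspace_def)
  show "\<psi> (coact V ?w i) = v i"
  proof (cases "i \<in> labels V")
    case False
    then show ?thesis
      using coact_outside(1)[OF V w] dual_filtR_zero[OF \<psi>] v by (auto simp: vspace_def)
  next
    case True
    have vR: "coact V v j \<in> filtR \<Omega> d" if "j \<in> labels V" for j
      using lV v that by (auto simp: coact_level_def tensor_space_def)
    have eR: "coact V (basis_vec j) i \<in> filtR \<Omega> d" if "j \<in> labels V" for j
      using coact_level_basis[OF lV that True] .
    have lin: "linear_on (filtR \<Omega> d) fscale (*) \<phi>" "linear_on (filtR \<Omega> d) fscale (*) \<psi>"
      using \<phi> \<psi> by (auto simp: dual_filtR_def)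
    have "coact V ?w i = (\<Sum>j\<in>labels V. fscale (?w j) (coact V (basis_vec j) i))"
      using coact_expansion[OF V w] by (auto simp: fun_eq_iff sum_fun_apply fscale_def mult.commute)
    then have "\<psi> (coact V ?w i) = (\<Sum>j\<in>labels V. ?w j * \<psi> (coact V (basis_vec j) i))"
      using linear_on_sum[OF subspace_filtR lin(2) representation_finite[OF V] eR, where c = ?w] by simp
    also have "\<dots> = (\<Sum>j\<in>labels V. \<psi> (coact V (basis_vec j) i) * ?w j)"
      by (simp add: mult.commute)
    also have "\<dots> = functional_tensor \<psi> \<phi>
        (\<lambda>(g, h). \<Sum>j\<in>labels V. coact V (basis_vec j) i g * coact V v j h)"
      by (rule functional_tensor_sum[OF subspace_filtR lin(2,1) representation_finite[OF V] eR vR, symmetric])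
    also have "(\<lambda>(g, h). \<Sum>j\<in>labels V. coact V (basis_vec j) i g * coact V v j h) =
        comult \<Omega> (coact V v i)"
    proof -
      have "coact_tensor_id V (coact V v) = (\<lambda>j. comult \<Omega> (coact V v j))"
        using V v by (simp add: representation_def)
      from fun_cong[OF this, of i] show ?thesis by (simp add: coact_tensor_id_def)
    qed
    also have "functional_tensor \<psi> \<phi> \<dots> = Comp (approx_cat \<Omega> d V) \<psi> \<phi> (coact V v i)"
      using vR[OF True] by (simp add: approx_cat_def)
    also have "\<dots> = counit (coact V v i)"
      using vR[OF True] unfolding comp by (simp add: approx_cat_def)
    also have "\<dots> = v i"
    proof -
      have "(\<lambda>j. counit (coact V v j)) = v" using V v by (simp add: representation_def)
      then show ?thesis by (rule fun_cong)
    qed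
    finally show ?thesis .
  qed
qed

text \<open>The action of \<psi> is a left inverse to that of \<phi>, so \<phi> injects S into T.
  Cardinality stands in for dimension, which suits the finite field of the application.\<close>

lemma isomorphic_in_card_le:
  assumes V: "representation \<Omega> V" and lV: "coact_level \<Omega> d V"
    and S: "fvs.subspace S" "S \<subseteq> vspace V" and T: "fvs.subspace T" "T \<subseteq> vspace V" "finite T"
    and iso: "isomorphic_in (approx_cat \<Omega> d V) S T"
  shows "card S \<le> card T"
proof -
  obtain \<phi> \<psi> where \<phi>: "\<phi> \<in> Hom (approx_cat \<Omega> d V) S T" and \<psi>: "\<psi> \<in> Hom (approx_cat \<Omega> d V) T S"
    and comp: "Comp (approx_cat \<Omega> d V) \<psi> \<phi> = Id (approx_cat \<Omega> d V) S"
    using iso unfolding isomorphic_in_def by blast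
  have d: "\<phi> \<in> dual_filtR \<Omega> d" "\<psi> \<in> dual_filtR \<Omega> d"
    using \<phi> \<psi> by (auto simp: approx_cat_def)
  show ?thesis
  proof (rule card_inj_on_le[OF _ _ T(3)])
    show "inj_on (\<lambda>v i. \<phi> (coact V v i)) S"
    proof (rule inj_on_inverseI)
      show "(\<lambda>i. \<psi> (coact V (\<lambda>i. \<phi> (coact V v i)) i)) = v" if "v \<in> S" for v
        using comp_eq_id_acts[OF V lV d comp] that S(2) by blast
    qed
    show "(\<lambda>v i. \<phi> (coact V v i)) ` S \<subseteq> T"
      using hom_acts_on_subspace[OF V lV S T(1,2) \<phi>] by blast
  qed
qed

lemma isomorphic_in_sym: "isomorphic_in C X Y \<Longrightarrow> isomorphic_in C Y X"
  unfolding isomorphic_in_def by blast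

text \<open>The same two functionals remain mutually inverse, since composition and identities are
  the same for V and V'; the functor only has to keep them in the morphism spaces.\<close>

lemma isomorphic_in_functor:
  assumes "very_faithful \<Omega> d Covariant V V' F"
    and "X \<in> Obj (approx_cat \<Omega> d V)" "Y \<in> Obj (approx_cat \<Omega> d V)"
    and "isomorphic_in (approx_cat \<Omega> d V) X Y"
  shows "isomorphic_in (approx_cat \<Omega> d V') (F X) (F Y)"
proof -
  obtain \<phi> \<psi> where *: "\<phi> \<in> Hom (approx_cat \<Omega> d V) X Y" "\<psi> \<in> Hom (approx_cat \<Omega> d V) Y X"
    "Comp (approx_cat \<Omega> d V) \<psi> \<phi> = Id (approx_cat \<Omega> d V) X"
    "Comp (approx_cat \<Omega> d V) \<phi> \<psi> = Id (approx_cat \<Omega> d V) Y"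
    using assms(4) unfolding isomorphic_in_def by blast
  have F: "is_functor (approx_cat \<Omega> d V) (approx_cat \<Omega> d V') F (\<lambda>\<phi>. \<phi>)"
    using assms(1) by simp
  have "\<phi> \<in> Hom (approx_cat \<Omega> d V') (F X) (F Y)" "\<psi> \<in> Hom (approx_cat \<Omega> d V') (F Y) (F X)"
    using F * assms(2,3) unfolding is_functor_def by blast+
  moreover have "Comp (approx_cat \<Omega> d V') \<psi> \<phi> = Id (approx_cat \<Omega> d V') (F X)"
    "Comp (approx_cat \<Omega> d V') \<phi> \<psi> = Id (approx_cat \<Omega> d V') (F Y)"
    using *(3,4) by (simp_all add: approx_cat_def)
  ultimately show ?thesis unfolding isomorphic_in_def by blast
qed


section \<open>The functor\<close>

text \<open>At t = A \<otimes> y, summing over the repeated index v contracts the second factor of U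
  \<otimes> U with y and gives M y. The coordinate 1 of A supplies the y to be subtracted while
  keeping the map linear in t, and the X_1 coordinate of A gives D y.\<close>

definition adjacency_contraction :: "'v set \<Rightarrow> ('v, 'k::field) vec \<Rightarrow> ('v, 'k) vec" where
  "adjacency_contraction \<Omega> t = (\<lambda>l. case l of
      SumL (Pt u) \<Rightarrow> if u \<in> \<Omega> then (\<Sum>v\<in>\<Omega>. t (Tens (SumL (Tens (Pt u) (Pt v))) (Pt v)))
        - t (Tens (SumR (SumR (SumR Unit))) (Pt u)) else 0
    | SumR (Pt u) \<Rightarrow> if u \<in> \<Omega> then t (Tens (SumR (SumL (Pt u))) (Pt u)) else 0
    | _ \<Rightarrow> 0)"

lemma equivariant_adjacency_contraction:
  fixes \<Omega> :: "'v set"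
  assumes fin: "finite \<Omega>"
  shows "equivariant (tensor_rep (graph_rep \<Omega>) (perm_rep \<Omega>)) (sum_rep (perm_rep \<Omega>) (perm_rep \<Omega>))
    (adjacency_contraction \<Omega> :: ('v, 'k::field) vec \<Rightarrow> _)"
proof -
  let ?V = "tensor_rep (graph_rep \<Omega>) (perm_rep \<Omega>) :: ('v, 'k) rep"
  let ?V' = "sum_rep (perm_rep \<Omega>) (perm_rep \<Omega>) :: ('v, 'k) rep"
  let ?f = "adjacency_contraction \<Omega> :: ('v, 'k) vec \<Rightarrow> _"
  have V: "label_permuting \<Omega> ?V" and V': "label_permuting \<Omega> ?V'"
    using fin by (auto intro!: label_permuting_tensor_rep label_permuting_graph_rep
        label_permuting_perm_rep label_permuting_sum_rep)
  have co: "coact ?V t j g = (if j \<in> labels ?V \<and> g \<in> symgrp \<Omega> then t (map_label (inv g) j) else 0)"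
    and co': "coact ?V' s j g = (if j \<in> labels ?V' \<and> g \<in> symgrp \<Omega> then s (map_label (inv g) j) else 0)"
    for t s j g using V V' by (auto simp: label_permuting_def)
  have labels: "Tens (SumL (Tens (Pt u) (Pt v))) (Pt w) \<in> labels ?V \<longleftrightarrow> u \<in> \<Omega> \<and> v \<in> \<Omega> \<and> w \<in> \<Omega>"
    "Tens (SumR (SumR (SumR Unit))) (Pt u) \<in> labels ?V \<longleftrightarrow> u \<in> \<Omega>"
    "Tens (SumR (SumL (Pt u))) (Pt v) \<in> labels ?V \<longleftrightarrow> u \<in> \<Omega> \<and> v \<in> \<Omega>" for u v w
    by (auto simp: tensor_rep_def sum_rep_def graph_rep_def perm_rep_def triv_rep_def)
  have labels': "l \<in> labels ?V' \<longleftrightarrow> (\<exists>u\<in>\<Omega>. l = SumL (Pt u) \<or> l = SumR (Pt u))" for l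
    by (auto simp: sum_rep_def perm_rep_def)
  show ?thesis
  proof (rule equivariantI[OF representation_label_permuting[OF V] representation_label_permuting[OF V']])
    show "?f ` vspace ?V \<subseteq> vspace ?V'"
      by (auto simp: vspace_def labels' adjacency_contraction_def split: label.splits)
    show "linear_on (vspace ?V) fscale fscale ?f"
      by (auto simp: linear_on_def adjacency_contraction_def fscale_def fun_eq_iff sum.distrib
          sum_distrib_left algebra_simps split: label.splits)
    fix t :: "('v, 'k) vec" and g assume g: "g \<in> symgrp \<Omega>"
    have g': "inv g permutes \<Omega>" using symgrp_inv[OF g] by (simp add: symgrp_def)
    have mem: "inv g u \<in> \<Omega> \<longleftrightarrow> u \<in> \<Omega>" for u using permutes_in_image[OF g'] .
    \<comment> \<open>The contraction over v is invariant because g^-1 only permutes the range of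
      summation.\<close>
    have sum: "(\<Sum>v\<in>\<Omega>. h (inv g v)) = (\<Sum>v\<in>\<Omega>. h v)" for h :: "'v \<Rightarrow> 'k"
      using sum.permute[OF g', of h] by (simp add: comp_def)
    show "(\<lambda>j. coact ?V' (?f t) j g) = ?f (\<lambda>i. coact ?V t i g)"
    proof
      fix l
      show "coact ?V' (?f t) l g = ?f (\<lambda>i. coact ?V t i g) l"
      proof (cases "l \<in> labels ?V'")
        case True
        then consider u where "u \<in> \<Omega>" "l = SumL (Pt u)" | u where "u \<in> \<Omega>" "l = SumR (Pt u)"
          using labels' by blast
        then show ?thesis
        proof cases
          case 1
          then show ?thesis
            using g True sum[of "\<lambda>v. t (Tens (SumL (Tens (Pt (inv g u)) (Pt v))) (Pt v))"]
            by (simp add: co' adjacency_contraction_def co labels mem)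
        next
          case 2
          then show ?thesis
            using g True by (simp add: co' adjacency_contraction_def co labels mem)
        qed
      next
        case False
        then show ?thesis
          by (auto simp: co' labels' adjacency_contraction_def split: label.splits)
      qed
    qed
  qed
qed

lemma constructible_tensor_image:
  assumes V: "label_permuting \<Omega> V" "coact_level \<Omega> p V" and W: "label_permuting \<Omega> W" "coact_level \<Omega> q W"
    and V': "rep_le \<Omega> d V'" and pq: "p + q \<le> d" and f: "equivariant (tensor_rep V W) V' f"
  shows "constructible \<Omega> d Covariant V V' (tensor_image W f)"
proof -
  have rV: "rep_le \<Omega> d V" using rep_leI[OF V] pq by simp
  have rW: "rep_le \<Omega> d W" using rep_leI[OF W] pq by simp
  have rVW: "rep_le \<Omega> d (tensor_rep V W)"
    using rep_leI[OF label_permuting_tensor_rep[OF V(1) W(1)] coact_level_tensor_rep[OF V(2) W(2)] pq] .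
  \<comment> \<open>The identity functor, which serves as the first tensor factor, is the image
    functor of the identity map.\<close>
  have "equivariant V V (\<lambda>v. v)"
    by (rule equivariantI[OF representation_label_permuting[OF V(1)] representation_label_permuting[OF V(1)]])
      (auto simp: linear_on_def)
  then have "constructible \<Omega> d Covariant V V (\<lambda>X. (\<lambda>v. v) ` X)"
    by (rule constructible.image[OF rV rV])
  moreover have "constructible \<Omega> d Covariant V W (\<lambda>X. vspace W)"
    by (rule constructible.const_space[OF rV rW])
  moreover have "ell \<Omega> V + ell \<Omega> W \<le> d"
    using ell_le[OF V(2)] ell_le[OF W(2)] pq by simp
  ultimately have "constructible \<Omega> d Covariant V (tensor_rep V W)
      (\<lambda>X. affine_set hull {tensor_vec y y' | y y'. y \<in> (\<lambda>v. v) ` X \<and> y' \<in> vspace W})"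
    by (rule constructible.tensor)
  from constructible.comp[OF this constructible.image[OF rVW V' f]]
  show ?thesis by (simp add: tensor_image_def[abs_def])
qed

text \<open>The map y \<mapsto> a \<otimes> y is linear, so the pure tensors with first factor a
  already form a subspace and the span adds nothing.\<close>

lemma tensor_image_singleton:
  "tensor_image W f {a} = (\<lambda>y. f (tensor_vec a y)) ` vspace W"
proof -
  have eq: "{tensor_vec x y | x y. x \<in> {a} \<and> y \<in> vspace W} = tensor_vec a ` vspace W" by auto
  have "fvs.subspace (tensor_vec a ` vspace W)"
    by (rule subspace_linear_on_image[OF linear_on_tensor_vec subspace_vspace order_refl])
  then have "fvs.span (tensor_vec a ` vspace W) = tensor_vec a ` vspace W" by simp
  then show ?thesis using tensor_image_nonempty[of "{a}" W f] by (simp only: eq) auto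
qed

section \<open>Counting in vector spaces over the field with two elements\<close>

lemma bit_UNIV: "(UNIV :: bit set) = {0, 1}"
  by (auto simp: bit_not_one_iff)

lemma bit_add_self: "(a :: bit) + a = 0"
  by (cases "a = 0") (auto simp: bit_not_zero_iff)

lemma bit_minus: "- (a :: bit) = a"
  using bit_add_self[of a] by (simp only: neg_eq_iff_add_eq_0)

text \<open>The only scalars are 0 and 1, so a new basis vector b turns the span into the disjoint
  union of itself and its translate by b. Each basis vector therefore doubles the
  cardinality.\<close>

lemma card_subspace_bit:
  fixes S :: "('i \<Rightarrow> bit) set"
  assumes "fvs.subspace S" "finite S"
  shows "card S = 2 ^ fvs.dim S"
proof -
  have "finite B \<Longrightarrow> fvs.independent B \<Longrightarrow> finite (fvs.span B) \<and> card (fvs.span B) = 2 ^ card B"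
    for B :: "('i \<Rightarrow> bit) set"
  proof (induction B rule: finite_induct)
    case empty
    then show ?case by simp
  next
    case (insert b B)
    have indep: "fvs.independent B" "b \<notin> fvs.span B"
      using insert.prems insert.hyps by (simp_all add: fvs.independent_insert)
    have span: "fvs.span (insert b B) = fvs.span B \<union> (\<lambda>x. x + b) ` fvs.span B"
    proof -
      have "x \<in> fvs.span (insert b B) \<longleftrightarrow> x \<in> fvs.span B \<or> x - b \<in> fvs.span B" for x
      proof -
        have "x \<in> fvs.span (insert b B) \<longleftrightarrow> (\<exists>k\<in>UNIV. x - fscale k b \<in> fvs.span B)"
          by (simp add: fvs.span_breakdown_eq)
        then show ?thesis by (simp add: bit_UNIV)
      qed
      moreover have "x - b \<in> fvs.span B \<longleftrightarrow> x \<in> (\<lambda>x. x + b) ` fvs.span B" for x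
        by (auto simp del: add_bit_eq_xor intro!: image_eqI[of _ _ "x - b"])
      ultimately show ?thesis by blast
    qed
    have "x + b \<notin> fvs.span B" if "x \<in> fvs.span B" for x
      using fvs.span_diff[OF _ that, of "x + b"] indep(2) by auto
    then have disj: "fvs.span B \<inter> (\<lambda>x. x + b) ` fvs.span B = {}" by blast
    have "card ((\<lambda>x. x + b) ` fvs.span B) = card (fvs.span B)"
      by (rule card_image) (simp add: inj_on_def)
    then show ?case
      using insert indep(1) span disj by (simp add: card_Un_disjoint)
  qed
  moreover obtain B where B: "B \<subseteq> S" "fvs.independent B" "S \<subseteq> fvs.span B" "card B = fvs.dim S"
    using fvs.basis_exists by metis
  moreover have "fvs.span B = S"
    using fvs.span_minimal[OF B(1) assms(1)] B(3) by blast
  ultimately show ?thesis using finite_subset[OF B(1) assms(2)] by metis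
qed

lemma affine_dim_eq_iff_card_eq:
  fixes S T :: "('i \<Rightarrow> bit) set"
  assumes "fvs.subspace S" "finite S" "fvs.subspace T" "finite T"
  shows "affine_dim S = affine_dim T \<longleftrightarrow> card S = card T"
proof -
  have "S \<noteq> {}" "T \<noteq> {}" using assms fvs.subspace_0 by blast+
  then show ?thesis
    using assms by (simp add: affine_dim_def direction_subspace card_subspace_bit)
qed

text \<open>Rank-nullity in counted form: every nonempty fibre is a translate of the kernel.\<close>

lemma card_image_times_card_kernel:
  assumes lin: "linear_on A fscale fscale f" and A: "fvs.subspace A" "finite A"
  shows "card (f ` A) * card {x \<in> A. f x = 0} = card A"
proof -
  have "card {x \<in> A. f x = f a} = card {x \<in> A. f x = 0}" if a: "a \<in> A" for a
  proof (rule bij_betw_same_card[of "\<lambda>x. x - a"])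
    have diff: "f (x - a) = f x - f a" if "x \<in> A" for x
    proof -
      have "f ((x - a) + a) = f (x - a) + f a"
        using lin a that fvs.subspace_diff[OF A(1)] unfolding linear_on_def by blast
      then show ?thesis by simp
    qed
    have add: "f (x + a) = f x + f a" if "x \<in> A" for x
      using lin a that unfolding linear_on_def by blast
    show "bij_betw (\<lambda>x. x - a) {x \<in> A. f x = f a} {x \<in> A. f x = 0}"
      by (rule bij_betwI[of _ _ _ "\<lambda>x. x + a"])
        (use a diff add fvs.subspace_diff[OF A(1)] fvs.subspace_add[OF A(1)] in auto)
  qed
  then have "(\<Sum>y\<in>f ` A. card {x \<in> A. f x = y}) = (\<Sum>y\<in>f ` A. card {x \<in> A. f x = 0})"
    by (intro sum.cong) auto
  moreover have "card A = (\<Sum>y\<in>f ` A. card {x \<in> A. f x = y})"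
    using sum.image_gen[OF A(2), of "\<lambda>_. 1 :: nat" f] by simp
  ultimately show ?thesis by simp
qed

lemma finite_vspace_bit:
  assumes "finite (labels V)"
  shows "finite (vspace V :: ('v, bit) vec set)"
proof -
  have eq: "vspace V = {v :: ('v, bit) vec. \<forall>i. (i \<in> labels V \<longrightarrow> v i \<in> UNIV) \<and> (i \<notin> labels V \<longrightarrow> v i = 0)}"
    by (auto simp: vspace_def)
  show ?thesis
    unfolding eq by (rule finite_set_of_finite_funs[OF assms]) (simp add: bit_UNIV)
qed


section \<open>Cai-Fuerer-Immerman graphs\<close>

text \<open>
  The two graphs share everything except the matching between the vertices of colour \<open>X\<^sub>2\<close>; \<open>T\<close> is
  the set of twisted edges.
\<close>

definition twisted_cfi :: "'x set \<Rightarrow> 'x set set \<Rightarrow> 'x set set \<Rightarrow> 'x cfi_vertex set set \<Rightarrow> bool" where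
  "twisted_cfi X E T D \<longleftrightarrow>
     (\<forall>d\<in>D. d \<subseteq> cfi_X X E) \<and>
     (\<forall>x Y x' e. CV x Y \<in> cfi_X1 X E \<longrightarrow> ({CV x Y, AV x' e} \<in> D \<longleftrightarrow> x' = x \<and> e \<in> Y)) \<and>
     (\<forall>x Y x' e. CV x Y \<in> cfi_X1 X E \<longrightarrow>
        ({CV x Y, BV x' e} \<in> D \<longleftrightarrow> x' = x \<and> e \<in> inc_edges E x - Y)) \<and>
     (\<forall>x x' e e'. {AV x e, AV x' e'} \<in> D \<longleftrightarrow> e' = e \<and> e \<in> E \<and> e = {x, x'} \<and> e \<notin> T) \<and>
     (\<forall>x x' e e'. {BV x e, BV x' e'} \<in> D \<longleftrightarrow> e' = e \<and> e \<in> E \<and> e = {x, x'} \<and> e \<notin> T) \<and>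
     (\<forall>x x' e e'. {AV x e, BV x' e'} \<in> D \<longleftrightarrow> e' = e \<and> e \<in> E \<and> e = {x, x'} \<and> e \<in> T)"

lemma cfi_edges_subset:
  assumes "simple_graph X E" "d \<in> cfi_edges X E"
  shows "d \<subseteq> cfi_X X E"
  using assms
  by (auto simp: cfi_edges_def cfi_X_def cfi_X1_def cfi_X2_def inc_edges_def simple_graph_def)

lemma twisted_cfi_edges: "simple_graph X E \<Longrightarrow> twisted_cfi X E {} (cfi_edges X E)"
  unfolding twisted_cfi_def
  by (intro conjI ballI allI impI cfi_edges_subset)
    (auto simp: cfi_edges_def doubleton_eq_iff cfi_X1_def)

lemma twisted_cfi_edges':
  assumes "simple_graph X E" "{x\<^sub>0, y\<^sub>0} \<in> E"
  shows "twisted_cfi X E {{x\<^sub>0, y\<^sub>0}} (cfi_edges' X E x\<^sub>0 y\<^sub>0)"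
proof -
  have base:
    "CV x Y \<in> cfi_X1 X E \<Longrightarrow> {CV x Y, AV x' e} \<in> cfi_edges X E \<longleftrightarrow> x' = x \<and> e \<in> Y"
    "CV x Y \<in> cfi_X1 X E \<Longrightarrow> {CV x Y, BV x' e} \<in> cfi_edges X E \<longleftrightarrow> x' = x \<and> e \<in> inc_edges E x - Y"
    "{AV x e, AV x' e'} \<in> cfi_edges X E \<longleftrightarrow> e' = e \<and> e \<in> E \<and> e = {x, x'}"
    "{BV x e, BV x' e'} \<in> cfi_edges X E \<longleftrightarrow> e' = e \<and> e \<in> E \<and> e = {x, x'}"
    "{AV x e, BV x' e'} \<notin> cfi_edges X E" for x x' Y e e'
    using twisted_cfi_edges[OF assms(1)] unfolding twisted_cfi_def by simp_all
  have sub: "d \<subseteq> cfi_X X E" if "d \<in> cfi_edges' X E x\<^sub>0 y\<^sub>0" for d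
    using that cfi_edges_subset[OF assms(1)] assms
    by (auto simp: cfi_edges'_def Let_def cfi_X_def cfi_X2_def inc_edges_def simple_graph_def)
  have "{AV x e, AV x' e'} \<in> cfi_edges' X E x\<^sub>0 y\<^sub>0 \<longleftrightarrow>
      e' = e \<and> e \<in> E \<and> e = {x, x'} \<and> e \<noteq> {x\<^sub>0, y\<^sub>0}"
    "{BV x e, BV x' e'} \<in> cfi_edges' X E x\<^sub>0 y\<^sub>0 \<longleftrightarrow>
      e' = e \<and> e \<in> E \<and> e = {x, x'} \<and> e \<noteq> {x\<^sub>0, y\<^sub>0}"
    "{AV x e, BV x' e'} \<in> cfi_edges' X E x\<^sub>0 y\<^sub>0 \<longleftrightarrow>
      e' = e \<and> e \<in> E \<and> e = {x, x'} \<and> e = {x\<^sub>0, y\<^sub>0}" for x x' e e'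
  proof -
    \<comment> \<open>Pairs of type AA, BB and AB never coincide, so the removal and addition of
      edges can be followed separately for each type.\<close>
    have "{AV x e, AV x' e'} = {AV a f, AV b f} \<longleftrightarrow> e = f \<and> e' = f \<and> {x, x'} = {a, b}"
      "{BV x e, BV x' e'} = {BV a f, BV b f} \<longleftrightarrow> e = f \<and> e' = f \<and> {x, x'} = {a, b}"
      "{AV x e, BV x' e'} = {AV a f, BV b f} \<longleftrightarrow> e = f \<and> e' = f \<and> x = a \<and> x' = b"
      "{AV x e, AV x' e'} \<noteq> {BV a f, BV b f}" "{BV x e, BV x' e'} \<noteq> {AV a f, AV b f}"
      "{AV x e, AV x' e'} \<noteq> {AV a f, BV b f}" "{BV x e, BV x' e'} \<noteq> {AV a f, BV b f}" for a b f
      by (auto simp: doubleton_eq_iff)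
    note eqs = this
    show "{AV x e, AV x' e'} \<in> cfi_edges' X E x\<^sub>0 y\<^sub>0 \<longleftrightarrow>
      e' = e \<and> e \<in> E \<and> e = {x, x'} \<and> e \<noteq> {x\<^sub>0, y\<^sub>0}"
      by (simp only: cfi_edges'_def Let_def Un_iff Diff_iff base insert_iff empty_iff eqs) metis
    show "{BV x e, BV x' e'} \<in> cfi_edges' X E x\<^sub>0 y\<^sub>0 \<longleftrightarrow>
      e' = e \<and> e \<in> E \<and> e = {x, x'} \<and> e \<noteq> {x\<^sub>0, y\<^sub>0}"
      by (simp only: cfi_edges'_def Let_def Un_iff Diff_iff base insert_iff empty_iff eqs) metis
    show "{AV x e, BV x' e'} \<in> cfi_edges' X E x\<^sub>0 y\<^sub>0 \<longleftrightarrow>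
      e' = e \<and> e \<in> E \<and> e = {x, x'} \<and> e = {x\<^sub>0, y\<^sub>0}"
      using assms(2)
      by (simp only: cfi_edges'_def Let_def Un_iff Diff_iff base insert_iff empty_iff eqs)
        (metis doubleton_eq_iff)
  qed
  moreover have "CV x Y \<in> cfi_X1 X E \<Longrightarrow> {CV x Y, AV x' e} \<in> cfi_edges' X E x\<^sub>0 y\<^sub>0 \<longleftrightarrow> x' = x \<and> e \<in> Y"
    "CV x Y \<in> cfi_X1 X E \<Longrightarrow>
      {CV x Y, BV x' e} \<in> cfi_edges' X E x\<^sub>0 y\<^sub>0 \<longleftrightarrow> x' = x \<and> e \<in> inc_edges E x - Y" for x x' Y e
    by (simp_all add: cfi_edges'_def Let_def base doubleton_eq_iff)
  ultimately show ?thesis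
    using sub unfolding twisted_cfi_def by simp
qed

lemma finite_edges: "simple_graph X E \<Longrightarrow> finite E"
  using finite_subset[of E "Pow X"] by (auto simp: simple_graph_def)

lemma finite_cfi_X:
  assumes "simple_graph X E"
  shows "finite (cfi_X X E)"
proof -
  have "cfi_X X E \<subseteq> (\<lambda>(x, Y). CV x Y) ` (X \<times> Pow E) \<union> (\<lambda>(x, e). AV x e) ` (X \<times> E) \<union>
      (\<lambda>(x, e). BV x e) ` (X \<times> E)"
    by (auto simp: cfi_X_def cfi_X1_def cfi_X2_def inc_edges_def)
  moreover have "finite X" using assms by (simp add: simple_graph_def)
  ultimately show ?thesis
    using finite_edges[OF assms] by (auto elim!: finite_subset)
qed

section \<open>The kernel at a graph vector as a system of gadget and matching equations\<close>

definition fixed_vectors ::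
  "'v set \<Rightarrow> 'v set \<Rightarrow> 'v set set \<Rightarrow> ('v, 'k::field) vec set" where
  "fixed_vectors \<Omega> X\<^sub>1 D = {y \<in> vspace (perm_rep \<Omega>).
     (\<forall>u\<in>\<Omega>. (\<Sum>v\<in>\<Omega>. if {u, v} \<in> D then y (Pt v) else 0) = y (Pt u)) \<and> (\<forall>u\<in>X\<^sub>1. y (Pt u) = 0)}"

text \<open>Finiteness matters here because a sum over an infinite index set is 0 by
  convention.\<close>

lemma graph_vec_coords:
  assumes "finite {(u, v). {u, v} \<in> D}" "finite X\<^sub>1"
  shows "(graph_vec X\<^sub>1 X\<^sub>2 D :: ('v, 'k::field) vec) (SumL (Tens (Pt u) (Pt v))) =
      (if {u, v} \<in> D then 1 else 0)"
    and "(graph_vec X\<^sub>1 X\<^sub>2 D :: ('v, 'k) vec) (SumR (SumL (Pt u))) = (if u \<in> X\<^sub>1 then 1 else 0)"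
    and "(graph_vec X\<^sub>1 X\<^sub>2 D :: ('v, 'k) vec) (SumR (SumR (SumR Unit))) = 1"
proof -
  have "(\<Sum>(a, b)\<in>{(u, v). {u, v} \<in> D}. tensor_vec (basis_vec (Pt a)) (basis_vec (Pt b)))
      (Tens (Pt u) (Pt v)) = (\<Sum>p\<in>{(u, v). {u, v} \<in> D}. if p = (u, v) then 1 else (0 :: 'k))"
    unfolding sum_fun_apply by (intro sum.cong) (auto simp: tensor_vec_def basis_vec_def split: if_splits)
  then show "(graph_vec X\<^sub>1 X\<^sub>2 D :: ('v, 'k) vec) (SumL (Tens (Pt u) (Pt v))) =
      (if {u, v} \<in> D then 1 else 0)"
    using assms(1) by (simp add: graph_vec_def sum_vec_def)
  have "(\<Sum>a\<in>X\<^sub>1. basis_vec (Pt a)) (Pt u) = (\<Sum>a\<in>X\<^sub>1. if a = u then 1 else (0 :: 'k))"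
    unfolding sum_fun_apply by (intro sum.cong) (auto simp: basis_vec_def)
  then show "(graph_vec X\<^sub>1 X\<^sub>2 D :: ('v, 'k) vec) (SumR (SumL (Pt u))) = (if u \<in> X\<^sub>1 then 1 else 0)"
    using assms(2) by (simp add: graph_vec_def sum_vec_def)
  show "(graph_vec X\<^sub>1 X\<^sub>2 D :: ('v, 'k) vec) (SumR (SumR (SumR Unit))) = 1"
    by (simp add: graph_vec_def sum_vec_def basis_vec_def)
qed

lemma sum_in_vspace: "(\<And>i. i \<in> I \<Longrightarrow> v i \<in> vspace V) \<Longrightarrow> (\<Sum>i\<in>I. v i) \<in> vspace V"
  using fvs.subspace_sum[OF subspace_vspace] by blast

lemma sum_vec_in_vspace: "x \<in> vspace V \<Longrightarrow> y \<in> vspace W \<Longrightarrow> sum_vec x y \<in> vspace (sum_rep V W)"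
  by (auto simp: vspace_def sum_vec_def sum_rep_def image_iff split: label.splits)

lemma graph_vec_in_vspace:
  assumes "\<forall>d\<in>D. d \<subseteq> \<Omega>" "X\<^sub>1 \<subseteq> \<Omega>" "X\<^sub>2 \<subseteq> \<Omega>"
  shows "graph_vec X\<^sub>1 X\<^sub>2 D \<in> vspace (graph_rep \<Omega>)"
  unfolding graph_vec_def graph_rep_def
proof (intro sum_vec_in_vspace sum_in_vspace)
  fix p assume "p \<in> {(u, v). {u, v} \<in> D}"
  then show "(case p of (u, v) \<Rightarrow> tensor_vec (basis_vec (Pt u)) (basis_vec (Pt v)))
      \<in> vspace (tensor_rep (perm_rep \<Omega>) (perm_rep \<Omega>))"
    using assms(1) by (auto intro!: tensor_vec_in_vspace basis_vec_in_vspace simp: perm_rep_def)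
qed (use assms in \<open>auto intro!: basis_vec_in_vspace simp: perm_rep_def triv_rep_def\<close>)

text \<open>The coordinates of the graph vector turn the two components of the contraction into M y
  - y and D y. All labels other than \<open>SumL (Pt u)\<close> and \<open>SumR (Pt u)\<close> with
  u in \<open>\<Omega>\<close> carry the value 0.\<close>

lemma kernel_adjacency_contraction:
  assumes fin: "finite \<Omega>" and D: "\<forall>d\<in>D. d \<subseteq> \<Omega>" and X1: "X\<^sub>1 \<subseteq> \<Omega>"
  shows "{y \<in> vspace (perm_rep \<Omega>). adjacency_contraction \<Omega> (tensor_vec (graph_vec X\<^sub>1 X\<^sub>2 D) y) = 0} =
    (fixed_vectors \<Omega> X\<^sub>1 D :: ('v, 'k::field) vec set)"
proof -
  have finD: "finite {(u, v). {u, v} \<in> D}"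
    by (rule finite_subset[of _ "\<Omega> \<times> \<Omega>"]) (use fin D in auto)
  note coords = graph_vec_coords[OF finD finite_subset[OF X1 fin]]
  have "adjacency_contraction \<Omega> (tensor_vec (graph_vec X\<^sub>1 X\<^sub>2 D) y) = 0 \<longleftrightarrow>
      (\<forall>u\<in>\<Omega>. (\<Sum>v\<in>\<Omega>. if {u, v} \<in> D then y (Pt v) else 0) = y (Pt u)) \<and> (\<forall>u\<in>X\<^sub>1. y (Pt u) = 0)"
    for y :: "('v, 'k) vec"
  proof -
    let ?c = "adjacency_contraction \<Omega> (tensor_vec (graph_vec X\<^sub>1 X\<^sub>2 D) y)"
    have L: "?c (SumL (Pt u)) = (\<Sum>v\<in>\<Omega>. if {u, v} \<in> D then y (Pt v) else 0) - y (Pt u)" if "u \<in> \<Omega>" for u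
      using that by (auto simp: adjacency_contraction_def tensor_vec_def coords intro!: sum.cong)
    have R: "?c (SumR (Pt u)) = (if u \<in> X\<^sub>1 then y (Pt u) else 0)" if "u \<in> \<Omega>" for u
      using that by (simp add: adjacency_contraction_def tensor_vec_def coords)
    have other: "?c l = 0" if "\<And>u. u \<in> \<Omega> \<Longrightarrow> l \<noteq> SumL (Pt u) \<and> l \<noteq> SumR (Pt u)" for l
      using that by (auto simp: adjacency_contraction_def split: label.splits)
    have "?c = 0 \<longleftrightarrow> (\<forall>u\<in>\<Omega>. ?c (SumL (Pt u)) = 0 \<and> ?c (SumR (Pt u)) = 0)"
    proof
      assume *: "\<forall>u\<in>\<Omega>. ?c (SumL (Pt u)) = 0 \<and> ?c (SumR (Pt u)) = 0"
      show "?c = 0"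
      proof
        fix l show "?c l = 0 l"
          using * other[of l] by (metis zero_fun_apply)
      qed
    qed simp
    then show ?thesis using X1 by (auto simp: L R)
  qed
  then show ?thesis unfolding fixed_vectors_def by blast
qed

lemma sum_unique_neighbour:
  assumes "finite \<Omega>" "w \<in> \<Omega>" "w \<notin> X\<^sub>1" "\<And>v. v \<in> X\<^sub>1 \<Longrightarrow> z v = 0"
    and "\<And>v. v \<in> \<Omega> \<Longrightarrow> v \<notin> X\<^sub>1 \<Longrightarrow> {u, v} \<in> D \<longleftrightarrow> v = w"
  shows "(\<Sum>v\<in>\<Omega>. if {u, v} \<in> D then z v else 0) = (z w :: 'k::field)"
proof -
  have "(\<Sum>v\<in>\<Omega>. if {u, v} \<in> D then z v else 0) = (\<Sum>v\<in>\<Omega>. if v = w then z v else 0)"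
    using assms(3-5) by (intro sum.cong) auto
  then show ?thesis using assms by simp
qed

lemma sum_gadget:
  assumes G: "simple_graph X E" and T: "twisted_cfi X E T D" and c: "CV x Y \<in> cfi_X1 X E"
    and z: "\<And>v. v \<in> cfi_X1 X E \<Longrightarrow> z v = (0 :: 'k::field)"
  shows "(\<Sum>v\<in>cfi_X X E. if {CV x Y, v} \<in> D then z v else 0) =
    (\<Sum>e\<in>inc_edges E x. if e \<in> Y then z (AV x e) else z (BV x e))"
proof -
  \<comment> \<open>\<open>h\<close> lists the neighbours of c_{x,Y} in X_2: one of the two vertices
    a, b for each edge at x.\<close>
  define h where "h e = (if e \<in> Y then AV x e else BV x e)" for e
  have inj: "inj_on h (inc_edges E x)" by (auto simp: inj_on_def h_def split: if_splits)
  have Y: "Y \<subseteq> inc_edges E x" "x \<in> X" using c by (auto simp: cfi_X1_def)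
  have sub: "h ` inc_edges E x \<subseteq> cfi_X X E" using Y(2) by (auto simp: h_def cfi_X_def cfi_X2_def)
  have adj: "{CV x Y, v} \<in> D \<longleftrightarrow> v \<in> h ` inc_edges E x" if "v \<in> cfi_X X E" "v \<notin> cfi_X1 X E" for v
  proof (cases v)
    case (CV x' Y')
    then show ?thesis using that by (auto simp: cfi_X_def cfi_X2_def)
  next
    case (AV x' e)
    then show ?thesis using T c Y by (auto simp: twisted_cfi_def h_def image_iff)
  next
    case (BV x' e)
    then show ?thesis using T c Y by (auto simp: twisted_cfi_def h_def image_iff)
  qed
  have "(\<Sum>v\<in>cfi_X X E. if {CV x Y, v} \<in> D then z v else 0) =
      (\<Sum>v\<in>cfi_X X E. if v \<in> h ` inc_edges E x then z v else 0)"
  proof (intro sum.cong refl)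
    fix v assume v: "v \<in> cfi_X X E"
    show "(if {CV x Y, v} \<in> D then z v else 0) = (if v \<in> h ` inc_edges E x then z v else 0)"
      using adj[OF v] z[of v] by (cases "v \<in> cfi_X1 X E") auto
  qed
  also have "\<dots> = (\<Sum>v\<in>h ` inc_edges E x. z v)"
    using sub finite_cfi_X[OF G] by (simp add: sum.If_cases Int_absorb1)
  also have "\<dots> = (\<Sum>e\<in>inc_edges E x. z (h e))" by (simp add: sum.reindex[OF inj])
  finally show ?thesis by (auto simp: h_def if_distrib)
qed

text \<open>As y vanishes on X_1, only neighbours in X_2 count. A vertex c_{x,Y} sees one vertex per
  incident edge and has value 0 itself, which gives the gadget equations. A vertex of X_2 sees
  exactly one other, its partner across the edge, which gives the matching equations.\<close>

lemma fixed_vectors_iff: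
  fixes y :: "('x cfi_vertex, 'k::field) vec"
  assumes G: "simple_graph X E" and T: "twisted_cfi X E T D"
    and y: "y \<in> vspace (perm_rep (cfi_X X E))" "\<forall>u\<in>cfi_X1 X E. y (Pt u) = 0"
  shows "y \<in> fixed_vectors (cfi_X X E) (cfi_X1 X E) D \<longleftrightarrow>
    (\<forall>x\<in>X. \<forall>Y. Y \<subseteq> inc_edges E x \<longrightarrow> even (card Y) \<longrightarrow>
       (\<Sum>e\<in>inc_edges E x. if e \<in> Y then y (Pt (AV x e)) else y (Pt (BV x e))) = 0) \<and>
    (\<forall>x x' e. e \<in> E \<longrightarrow> e = {x, x'} \<longrightarrow>
       (if e \<in> T then y (Pt (AV x e)) = y (Pt (BV x' e))
        else y (Pt (AV x e)) = y (Pt (AV x' e)) \<and> y (Pt (BV x e)) = y (Pt (BV x' e))))"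
    (is "_ \<longleftrightarrow> ?gadget \<and> ?matching")
proof -
  let ?\<Omega> = "cfi_X X E"
  let ?S = "\<lambda>u. \<Sum>v\<in>?\<Omega>. if {u, v} \<in> D then y (Pt v) else 0"
  note fin = finite_cfi_X[OF G]
  have edge: "x \<in> X" "x' \<in> X" "x \<noteq> x'" if "{x, x'} \<in> E" for x x'
    using G that by (auto simp: simple_graph_def)
  have nbrA: "?S (AV x e) = y (Pt (if e \<in> T then BV x' e else AV x' e))"
    and nbrB: "?S (BV x e) = y (Pt (if e \<in> T then AV x' e else BV x' e))"
    if e: "e \<in> E" "e = {x, x'}" for x x' e
  proof -
    have mem: "AV x' e \<in> ?\<Omega>" "BV x' e \<in> ?\<Omega>" "AV x' e \<notin> cfi_X1 X E" "BV x' e \<notin> cfi_X1 X E"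
      using e edge by (auto simp: cfi_X_def cfi_X1_def cfi_X2_def inc_edges_def)
    have uniq: "e = {x, a} \<longleftrightarrow> a = x'" "e = {a, x} \<longleftrightarrow> a = x'" for a
      using e(2) by (auto simp: doubleton_eq_iff)
    have AA: "{AV x e, AV a f} \<in> D \<longleftrightarrow> f = e \<and> a = x' \<and> e \<notin> T"
      and BB: "{BV x e, BV a f} \<in> D \<longleftrightarrow> f = e \<and> a = x' \<and> e \<notin> T"
      and AB: "{AV x e, BV a f} \<in> D \<longleftrightarrow> f = e \<and> a = x' \<and> e \<in> T" for a f
      using T e(1) uniq unfolding twisted_cfi_def by simp_all
    \<comment> \<open>The pair is read in the opposite order to fit the AB clause of
      \<open>twisted_cfi\<close>.\<close>
    have BA: "{BV x e, AV a f} \<in> D \<longleftrightarrow> f = e \<and> a = x' \<and> e \<in> T" for a f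
    proof -
      have "{AV a f, BV x e} \<in> D \<longleftrightarrow> e = f \<and> f \<in> E \<and> f = {a, x} \<and> f \<in> T"
        using T unfolding twisted_cfi_def by simp
      then show ?thesis using e(1) uniq by (auto simp: insert_commute)
    qed
    have "{AV x e, v} \<in> D \<longleftrightarrow> v = (if e \<in> T then BV x' e else AV x' e)"
      "{BV x e, v} \<in> D \<longleftrightarrow> v = (if e \<in> T then AV x' e else BV x' e)"
      if "v \<in> ?\<Omega>" "v \<notin> cfi_X1 X E" for v
      using that by (cases v; auto simp: AA AB BA BB cfi_X_def cfi_X2_def)+
    then show "?S (AV x e) = y (Pt (if e \<in> T then BV x' e else AV x' e))"
      "?S (BV x e) = y (Pt (if e \<in> T then AV x' e else BV x' e))"
      using mem y(2) by (intro sum_unique_neighbour[OF fin, where X\<^sub>1 = "cfi_X1 X E" and z = "\<lambda>v. y (Pt v)"]; auto)+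
  qed
  have nbrC: "?S (CV x Y) = (\<Sum>e\<in>inc_edges E x. if e \<in> Y then y (Pt (AV x e)) else y (Pt (BV x e)))"
    if "CV x Y \<in> cfi_X1 X E" for x Y
    using sum_gadget[OF G T that, of "\<lambda>v. y (Pt v)"] y(2) by simp
  have inc: "\<exists>x'. e = {x, x'}" if "e \<in> inc_edges E x" for x e
    using that G by (auto simp: inc_edges_def simple_graph_def card_2_iff)
  have fixed: "y \<in> fixed_vectors ?\<Omega> (cfi_X1 X E) D \<longleftrightarrow> (\<forall>u\<in>?\<Omega>. ?S u = y (Pt u))"
    using y by (simp add: fixed_vectors_def)
  show ?thesis
  proof
    assume "y \<in> fixed_vectors ?\<Omega> (cfi_X1 X E) D"
    then have S: "?S u = y (Pt u)" if "u \<in> ?\<Omega>" for u using fixed that by blast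
    have ?gadget
    proof (intro ballI allI impI)
      fix x Y assume "x \<in> X" "Y \<subseteq> inc_edges E x" "even (card Y)"
      then have c: "CV x Y \<in> cfi_X1 X E" by (auto simp: cfi_X1_def)
      then have "?S (CV x Y) = 0" using S[of "CV x Y"] y(2) by (simp add: cfi_X_def)
      then show "(\<Sum>e\<in>inc_edges E x. if e \<in> Y then y (Pt (AV x e)) else y (Pt (BV x e))) = 0"
        using nbrC[OF c] by simp
    qed
    moreover have ?matching
    proof (intro allI impI)
      fix x x' e assume e: "e \<in> E" "e = {x, x'}"
      have "AV x e \<in> ?\<Omega>" "BV x e \<in> ?\<Omega>"
        using e edge by (auto simp: cfi_X_def cfi_X2_def inc_edges_def)
      then show "if e \<in> T then y (Pt (AV x e)) = y (Pt (BV x' e))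
        else y (Pt (AV x e)) = y (Pt (AV x' e)) \<and> y (Pt (BV x e)) = y (Pt (BV x' e))"
        using S[of "AV x e"] S[of "BV x e"] nbrA[OF e] nbrB[OF e] by (cases "e \<in> T") simp_all
    qed
    ultimately show "?gadget \<and> ?matching" ..
  next
    assume gm: "?gadget \<and> ?matching"
    have "?S u = y (Pt u)" if "u \<in> ?\<Omega>" for u
    proof (cases u)
      case (CV x Y)
      then have c: "CV x Y \<in> cfi_X1 X E" using that by (auto simp: cfi_X_def cfi_X2_def)
      then have "x \<in> X" "Y \<subseteq> inc_edges E x" "even (card Y)" by (auto simp: cfi_X1_def)
      then show ?thesis using gm nbrC[OF c] y(2) c CV by auto
    next
      case (AV x e)
      then have "e \<in> inc_edges E x" using that by (auto simp: cfi_X_def cfi_X1_def cfi_X2_def)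
      with inc obtain x' where e: "e \<in> E" "e = {x, x'}" by (auto simp: inc_edges_def)
      then have "if e \<in> T then y (Pt (AV x e)) = y (Pt (BV x' e))
        else y (Pt (AV x e)) = y (Pt (AV x' e)) \<and> y (Pt (BV x e)) = y (Pt (BV x' e))"
        using gm by blast
      then show ?thesis unfolding AV nbrA[OF e] by (auto split: if_splits)
    next
      case (BV x e)
      then have "e \<in> inc_edges E x" using that by (auto simp: cfi_X_def cfi_X1_def cfi_X2_def)
      with inc obtain x' where e: "e \<in> E" "e = {x, x'}" by (auto simp: inc_edges_def)
      \<comment> \<open>On a twisted edge the condition equates a at the first end with b at the
        second, so the equation at this b-vertex comes from the reversed orientation.\<close>
      then have "e = {x', x}" by blast
      then have "if e \<in> T then y (Pt (AV x' e)) = y (Pt (BV x e))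
        else y (Pt (AV x' e)) = y (Pt (AV x e)) \<and> y (Pt (BV x' e)) = y (Pt (BV x e))"
        using gm e(1) by blast
      then show ?thesis unfolding BV nbrB[OF e] by (auto split: if_splits)
    qed
    then show "y \<in> fixed_vectors ?\<Omega> (cfi_X1 X E) D" using fixed by blast
  qed
qed


section \<open>The parity argument at the twisted edge\<close>

text \<open>Sum the equations with Y empty over the set C of vertices with nonzero difference a - b,
  and regroup by edges. An untwisted edge has both ends in C or neither, and its two equal terms
  cancel; the twisted edge alone contributes its difference, which is nonzero by assumption for
  contradiction.\<close>

lemma twist_forces_equality:
  fixes a b :: "'x \<Rightarrow> 'x set \<Rightarrow> bit"
  assumes G: "simple_graph X E" and e\<^sub>0: "{x\<^sub>0, y\<^sub>0} \<in> E"
    and gadget: "\<And>x Y. x \<in> X \<Longrightarrow> Y \<subseteq> inc_edges E x \<Longrightarrow> even (card Y) \<Longrightarrow>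
      (\<Sum>e\<in>inc_edges E x. if e \<in> Y then a x e else b x e) = 0"
    and matching: "\<And>x x' e. e \<in> E \<Longrightarrow> e = {x, x'} \<Longrightarrow> e \<noteq> {x\<^sub>0, y\<^sub>0} \<Longrightarrow> a x e = a x' e \<and> b x e = b x' e"
    and twist: "a x\<^sub>0 {x\<^sub>0, y\<^sub>0} = b y\<^sub>0 {x\<^sub>0, y\<^sub>0}" "a y\<^sub>0 {x\<^sub>0, y\<^sub>0} = b x\<^sub>0 {x\<^sub>0, y\<^sub>0}"
  shows "a x\<^sub>0 {x\<^sub>0, y\<^sub>0} = b x\<^sub>0 {x\<^sub>0, y\<^sub>0}"
proof (rule ccontr)
  let ?e = "{x\<^sub>0, y\<^sub>0}"
  assume neq: "a x\<^sub>0 ?e \<noteq> b x\<^sub>0 ?e"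
  have finE: "finite E" using finite_edges[OF G] .
  have finX: "finite X" using G by (simp add: simple_graph_def)
  have fin: "finite (inc_edges E x)" for x using finE by (simp add: inc_edges_def)
  define s where "s x e = a x e - b x e" for x e
  \<comment> \<open>Both {e, f} and the empty set have even size. Subtracting the two gadget
    equations leaves only the terms at e and f, and signs do not matter in characteristic 2.\<close>
  have same: "s x e = s x f" if x: "x \<in> X" and e: "e \<in> inc_edges E x" and f: "f \<in> inc_edges E x" for x e f
  proof (cases "e = f")
    case False
    then have "(\<Sum>h\<in>inc_edges E x. if h \<in> {e, f} then a x h else b x h) -
        (\<Sum>h\<in>inc_edges E x. if h \<in> {} then a x h else b x h) = 0"
      using gadget[OF x, of "{e, f}"] gadget[OF x, of "{}"] e f by simp
    then have "(\<Sum>h\<in>inc_edges E x. if h \<in> {e, f} then s x h else 0) = 0"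
      unfolding sum_subtractf[symmetric]
      by (subst (asm) sum.cong[OF refl, of _ _ "\<lambda>h. if h \<in> {e, f} then s x h else 0"]) (auto simp: s_def)
    moreover have "inc_edges E x \<inter> {e, f} = {e, f}" using e f by auto
    ultimately have "(\<Sum>h\<in>{e, f}. s x h) = 0"
      using sum.inter_restrict[OF fin, of "\<lambda>h. s x h" x "{e, f}"] by argo
    then have "s x e + s x f = 0" using False by (simp del: add_bit_eq_xor)
    then have "s x e = - s x f" by (simp only: eq_neg_iff_add_eq_0)
    then show ?thesis by (simp only: bit_minus)
  qed simp
  define C where "C = {x \<in> X. \<exists>e\<in>inc_edges E x. s x e \<noteq> 0}"
  have C_iff: "x \<in> C \<longleftrightarrow> s x e \<noteq> 0" if "x \<in> X" "e \<in> inc_edges E x" for x e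
  proof
    assume "x \<in> C"
    then obtain f where "f \<in> inc_edges E x" "s x f \<noteq> 0" by (auto simp: C_def)
    then show "s x e \<noteq> 0" using same[OF that(1) _ that(2), of f] by simp
  qed (use that in \<open>auto simp: C_def\<close>)
  have "(\<Sum>x\<in>C. \<Sum>e\<in>{e \<in> E. x \<in> e}. b x e) = 0"
  proof (rule sum.neutral, rule ballI)
    fix x assume "x \<in> C"
    then show "(\<Sum>e\<in>{e \<in> E. x \<in> e}. b x e) = 0"
      using gadget[of x "{}"] by (simp add: C_def inc_edges_def)
  qed
  then have "(\<Sum>e\<in>E. \<Sum>x\<in>{x \<in> C. x \<in> e}. b x e) = 0"
    using sum.swap_restrict[of C E "\<lambda>x e. b x e" "\<lambda>x e. x \<in> e"] finX finE by (simp add: C_def)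
  moreover have "(\<Sum>x\<in>{x \<in> C. x \<in> e}. b x e) = (if e = ?e then s x\<^sub>0 ?e else 0)" if e: "e \<in> E" for e
  proof -
    \<comment> \<open>The twist interchanges a and b between the two ends, so the differences there
      are negatives of each other and both ends lie in \<open>C\<close>.\<close>
    have s0: "s y\<^sub>0 ?e \<noteq> 0" "s x\<^sub>0 ?e \<noteq> 0" using neq twist by (auto simp: s_def)
    have "card e = 2" "e \<subseteq> X" using G e by (auto simp: simple_graph_def)
    then obtain x x' where x: "e = {x, x'}" "x \<noteq> x'" "x \<in> X" "x' \<in> X"
      by (auto simp: card_2_iff)
    have inc: "e \<in> inc_edges E x" "e \<in> inc_edges E x'" using e x by (auto simp: inc_edges_def)
    show ?thesis
    proof (cases "e = ?e")
      case True
      then have "{x, x'} = {x\<^sub>0, y\<^sub>0}" "x\<^sub>0 \<noteq> y\<^sub>0" using x by auto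
      moreover have "x\<^sub>0 \<in> C" "y\<^sub>0 \<in> C"
      proof -
        have "z \<in> X" "?e \<in> inc_edges E z" if "z \<in> ?e" for z
          using that e \<open>e \<subseteq> X\<close> True by (auto simp: inc_edges_def)
        then show "x\<^sub>0 \<in> C" "y\<^sub>0 \<in> C" using C_iff s0 by blast+
      qed
      ultimately have "{x \<in> C. x \<in> e} = {x\<^sub>0, y\<^sub>0}" using True by blast
      then have "(\<Sum>x\<in>{x \<in> C. x \<in> e}. b x e) = b x\<^sub>0 ?e + b y\<^sub>0 ?e"
        using \<open>x\<^sub>0 \<noteq> y\<^sub>0\<close> True by (simp del: add_bit_eq_xor)
      \<comment> \<open>By the twist, b at the second end is a at the first.\<close>
      also have "\<dots> = a x\<^sub>0 ?e + - b x\<^sub>0 ?e"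
        by (simp only: twist(1) bit_minus add.commute)
      finally show ?thesis using True by (simp add: s_def del: add_bit_eq_xor)
    next
      case False
      have m: "a x e = a x' e" "b x e = b x' e" using matching[OF e x(1) False] by auto
      then have "x \<in> C \<longleftrightarrow> x' \<in> C"
        using C_iff[OF x(3) inc(1)] C_iff[OF x(4) inc(2)] by (simp add: s_def)
      then have "{x \<in> C. x \<in> e} = {} \<or> {x \<in> C. x \<in> e} = {x, x'}" using x(1) by auto
      then have "(\<Sum>x\<in>{x \<in> C. x \<in> e}. b x e) = 0"
      proof
        assume eq: "{x \<in> C. x \<in> e} = {x, x'}"
        have "(\<Sum>x\<in>{x \<in> C. x \<in> e}. b x e) = b x e + b x' e"
          unfolding eq using x(2) by (simp del: add_bit_eq_xor)
        then show ?thesis by (simp only: m(2) bit_add_self)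
      next
        assume "{x \<in> C. x \<in> e} = {}"
        then show ?thesis by (simp only: sum.empty)
      qed
      then show ?thesis using False by simp
    qed
  qed
  ultimately have "(\<Sum>e\<in>E. if e = ?e then s x\<^sub>0 ?e else 0) = 0" by simp
  then have "s x\<^sub>0 ?e = 0" using finE e\<^sub>0 by simp
  then show False using neq by (simp only: s_def right_minus_eq)
qed

text \<open>For a solution of the twisted system all four values at the twisted edge coincide, so
  the straight matching equations hold there just as the crossed ones do. Strictness comes from an
  explicit solution of the untwisted system.\<close>

lemma fixed_vectors_twisted_psubset:
  assumes G: "simple_graph X E" and e\<^sub>0: "{x\<^sub>0, y\<^sub>0} \<in> E"
  shows "(fixed_vectors (cfi_X X E) (cfi_X1 X E) (cfi_edges' X E x\<^sub>0 y\<^sub>0) :: ('x cfi_vertex, bit) vec set)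
    \<subset> fixed_vectors (cfi_X X E) (cfi_X1 X E) (cfi_edges X E)"
    (is "?S' \<subset> ?S")
proof
  let ?e = "{x\<^sub>0, y\<^sub>0}"
  note iff = fixed_vectors_iff[OF G twisted_cfi_edges[OF G]]
  note iff' = fixed_vectors_iff[OF G twisted_cfi_edges'[OF G e\<^sub>0]]
  have basic: "y \<in> vspace (perm_rep (cfi_X X E))" "\<forall>u\<in>cfi_X1 X E. y (Pt u) = 0"
    if "y \<in> fixed_vectors (cfi_X X E) (cfi_X1 X E) D" for y :: "('x cfi_vertex, bit) vec" and D
    using that by (auto simp: fixed_vectors_def)
  have eqs: "y (Pt (AV x\<^sub>0 ?e)) = y (Pt (BV x\<^sub>0 ?e))" "y (Pt (AV y\<^sub>0 ?e)) = y (Pt (BV x\<^sub>0 ?e))"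
    "y (Pt (BV y\<^sub>0 ?e)) = y (Pt (BV x\<^sub>0 ?e))" if y: "y \<in> ?S'" for y
  proof -
    note yy = iff'[OF basic[OF y], THEN iffD1, OF y]
    have gadget: "(\<Sum>e\<in>inc_edges E x. if e \<in> Y then y (Pt (AV x e)) else y (Pt (BV x e))) = 0"
      if "x \<in> X" "Y \<subseteq> inc_edges E x" "even (card Y)" for x Y
      using yy that by blast
    have matching: "if e \<in> {?e} then y (Pt (AV x e)) = y (Pt (BV x' e))
        else y (Pt (AV x e)) = y (Pt (AV x' e)) \<and> y (Pt (BV x e)) = y (Pt (BV x' e))"
      if "e \<in> E" "e = {x, x'}" for x x' e
      using yy that by blast
    have twist: "y (Pt (AV x\<^sub>0 ?e)) = y (Pt (BV y\<^sub>0 ?e))" "y (Pt (AV y\<^sub>0 ?e)) = y (Pt (BV x\<^sub>0 ?e))"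
      using matching[OF e\<^sub>0 refl] matching[OF e\<^sub>0, of y\<^sub>0 x\<^sub>0] by (auto simp: insert_commute)
    have "y (Pt (AV x\<^sub>0 ?e)) = y (Pt (BV x\<^sub>0 ?e))"
    proof (rule twist_forces_equality[OF G e\<^sub>0, where a = "\<lambda>x e. y (Pt (AV x e))"
          and b = "\<lambda>x e. y (Pt (BV x e))"])
      show "y (Pt (AV x e)) = y (Pt (AV x' e)) \<and> y (Pt (BV x e)) = y (Pt (BV x' e))"
        if "e \<in> E" "e = {x, x'}" "e \<noteq> ?e" for x x' e
        using matching[OF that(1,2)] that(3) by (metis singletonD)
    qed (use gadget twist in auto)
    with twist show "y (Pt (AV x\<^sub>0 ?e)) = y (Pt (BV x\<^sub>0 ?e))"
      "y (Pt (AV y\<^sub>0 ?e)) = y (Pt (BV x\<^sub>0 ?e))" "y (Pt (BV y\<^sub>0 ?e)) = y (Pt (BV x\<^sub>0 ?e))" by auto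
  qed
  show "?S' \<subseteq> ?S"
  proof
    fix y assume y: "y \<in> ?S'"
    note yy = iff'[OF basic[OF y], THEN iffD1, OF y]
    show "y \<in> ?S"
    proof (rule iff[OF basic[OF y], THEN iffD2], intro conjI)
      show "\<forall>x\<in>X. \<forall>Y. Y \<subseteq> inc_edges E x \<longrightarrow> even (card Y) \<longrightarrow>
        (\<Sum>e\<in>inc_edges E x. if e \<in> Y then y (Pt (AV x e)) else y (Pt (BV x e))) = 0"
        using yy by blast
      show "\<forall>x x' e. e \<in> E \<longrightarrow> e = {x, x'} \<longrightarrow>
        (if e \<in> {} then y (Pt (AV x e)) = y (Pt (BV x' e))
         else y (Pt (AV x e)) = y (Pt (AV x' e)) \<and> y (Pt (BV x e)) = y (Pt (BV x' e)))"
      proof (intro allI impI)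
        fix x x' e assume e: "e \<in> E" "e = {x, x'}"
        have "y (Pt (AV x e)) = y (Pt (AV x' e)) \<and> y (Pt (BV x e)) = y (Pt (BV x' e))"
        proof (cases "e = ?e")
          case True
          then have "x = x\<^sub>0 \<and> x' = y\<^sub>0 \<or> x = y\<^sub>0 \<and> x' = x\<^sub>0" using e(2) by (auto simp: doubleton_eq_iff)
          then show ?thesis using eqs[OF y] True by auto
        next
          case False
          have "if e \<in> {?e} then y (Pt (AV x e)) = y (Pt (BV x' e))
            else y (Pt (AV x e)) = y (Pt (AV x' e)) \<and> y (Pt (BV x e)) = y (Pt (BV x' e))"
            using yy e by blast
          then show ?thesis using False by (metis singletonD)
        qed
        then show "if e \<in> {} then y (Pt (AV x e)) = y (Pt (BV x' e))
          else y (Pt (AV x e)) = y (Pt (AV x' e)) \<and> y (Pt (BV x e)) = y (Pt (BV x' e))" by simp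
      qed
    qed
  qed
  \<comment> \<open>The indicator of the a-vertices. Its gadget sums are |Y| mod 2 = 0 and it
    respects the straight matching, but it separates a from b at the twisted edge, contrary to
    \<open>eqs\<close>.\<close>
  define w :: "('x cfi_vertex, bit) vec" where
    "w l = (if \<exists>x e. l = Pt (AV x e) \<and> AV x e \<in> cfi_X X E then 1 else 0)" for l
  have w: "w \<in> vspace (perm_rep (cfi_X X E))" "\<forall>u\<in>cfi_X1 X E. w (Pt u) = 0"
    by (auto simp: w_def vspace_def perm_rep_def cfi_X1_def)
  have wA: "w (Pt (AV x e)) = 1" if "x \<in> X" "e \<in> inc_edges E x" for x e
    using that by (simp add: w_def cfi_X_def cfi_X2_def)
  have wB: "w (Pt (BV x e)) = 0" for x e by (simp add: w_def)
  have edge: "x \<in> X" "e \<in> inc_edges E x" if "e \<in> E" "x \<in> e" for x e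
    using G that by (auto simp: simple_graph_def inc_edges_def)
  have "w \<in> ?S"
  proof (rule iff[OF w, THEN iffD2], intro conjI ballI allI impI)
    fix x Y assume x: "x \<in> X" and Y: "Y \<subseteq> inc_edges E x" "even (card Y)"
    have fin: "finite (inc_edges E x)" using finite_edges[OF G] by (simp add: inc_edges_def)
    have "(\<Sum>e\<in>inc_edges E x. if e \<in> Y then w (Pt (AV x e)) else w (Pt (BV x e))) =
        (\<Sum>e\<in>inc_edges E x. if e \<in> Y then 1 else 0)"
      by (intro sum.cong) (auto simp: wA[OF x] wB)
    also have "\<dots> = of_nat (card Y)"
      using fin Y(1) by (simp add: sum.If_cases Int_absorb1)
    also have "\<dots> = 0"
    proof -
      obtain k where "card Y = 2 * k" using Y(2) by blast
      then have "of_nat (card Y) = (2 :: bit) * of_nat k" by (simp only: of_nat_mult of_nat_numeral)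
      then show ?thesis by (simp only: bit_2_eq_0 mult_zero_left)
    qed
    finally show "(\<Sum>e\<in>inc_edges E x. if e \<in> Y then w (Pt (AV x e)) else w (Pt (BV x e))) = 0" .
  next
    fix x x' e assume e: "e \<in> E" "e = {x, x'}"
    then have "w (Pt (AV x e)) = 1" "w (Pt (AV x' e)) = 1"
      using wA edge[OF e(1)] by auto
    then show "if e \<in> {} then w (Pt (AV x e)) = w (Pt (BV x' e))
        else w (Pt (AV x e)) = w (Pt (AV x' e)) \<and> w (Pt (BV x e)) = w (Pt (BV x' e))"
      by (simp add: wB)
  qed
  moreover have "w \<notin> ?S'"
    using eqs(1)[of w] wA[OF edge[OF e\<^sub>0], of x\<^sub>0] wB by auto
  ultimately show "?S' \<noteq> ?S" by blast
qed

theorem theorem1p11: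
  fixes X :: "'x set" and E :: "'x set set" and x\<^sub>0 y\<^sub>0 :: 'x
  defines "\<Omega> \<equiv> cfi_X X E"
  defines "V \<equiv> (graph_rep \<Omega> :: ('x cfi_vertex, bit) rep)"
  defines "A \<equiv> (graph_vec (cfi_X1 X E) (cfi_X2 X E) (cfi_edges X E) :: ('x cfi_vertex, bit) vec)"
  defines "A' \<equiv> (graph_vec (cfi_X1 X E) (cfi_X2 X E) (cfi_edges' X E x\<^sub>0 y\<^sub>0) :: ('x cfi_vertex, bit) vec)"
  assumes "simple_graph X E"
    and "{x\<^sub>0, y\<^sub>0} \<in> E"
    and "\<not> colored_isomorphic (cfi_X1 X E) (cfi_X2 X E) (cfi_edges X E) (cfi_edges' X E x\<^sub>0 y\<^sub>0)"
  shows "(\<exists>c V' F. rep_le \<Omega> 3 V' \<and> very_faithful \<Omega> 3 c V V' F \<and> constructible \<Omega> 3 c V V' F \<and>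
            affine_dim (F {A}) \<noteq> affine_dim (F {A'})) \<and>
         \<not> isomorphic_in (approx_cat \<Omega> 3 V) {A} {A'}"
proof -
  note G = assms(5) and e\<^sub>0 = assms(6)
  define U where "U = (perm_rep \<Omega> :: ('x cfi_vertex, bit) rep)"
  define V' where "V' = sum_rep U U"
  define f where "f = (adjacency_contraction \<Omega> :: ('x cfi_vertex, bit) vec \<Rightarrow> _)"
  define F where "F = tensor_image U f"
  have fin: "finite \<Omega>" unfolding \<Omega>_def by (rule finite_cfi_X[OF G])
  have V: "label_permuting \<Omega> V" "coact_level \<Omega> 2 V"
    unfolding V_def using label_permuting_graph_rep[OF fin] coact_level_graph_rep by auto
  have U: "label_permuting \<Omega> U" "coact_level \<Omega> 1 U"
    unfolding U_def using label_permuting_perm_rep[OF fin] coact_level_perm_rep by auto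
  have V': "label_permuting \<Omega> V'" "coact_level \<Omega> 1 V'"
    unfolding V'_def using label_permuting_sum_rep[OF U(1) U(1)] coact_level_sum_rep[OF U(2) U(2)] by auto
  have rV': "rep_le \<Omega> 3 V'" using rep_leI[OF V'] by simp
  have f: "equivariant (tensor_rep V U) V' f"
    unfolding f_def V_def U_def V'_def by (rule equivariant_adjacency_contraction[OF fin])
  note rep = representation_label_permuting
  \<comment> \<open>The levels 2 of \<open>V\<close> and 1 of \<open>U\<close> add up to exactly
    3.\<close>
  have vf: "very_faithful \<Omega> 3 Covariant V V' F"
    unfolding F_def
    by (rule very_faithful_tensor_image[OF rep[OF V(1)] rep[OF U(1)] rep[OF V'(1)] V(2) U(2) _ f]) simp
  have con: "constructible \<Omega> 3 Covariant V V' F"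
    unfolding F_def by (rule constructible_tensor_image[OF V U rV' _ f]) simp
  have X12: "cfi_X1 X E \<subseteq> \<Omega>" "cfi_X2 X E \<subseteq> \<Omega>" by (auto simp: \<Omega>_def cfi_X_def)
  have D: "\<forall>d\<in>cfi_edges X E. d \<subseteq> \<Omega>" "\<forall>d\<in>cfi_edges' X E x\<^sub>0 y\<^sub>0. d \<subseteq> \<Omega>"
    using twisted_cfi_edges[OF G] twisted_cfi_edges'[OF G e\<^sub>0] by (simp_all add: twisted_cfi_def \<Omega>_def)
  have AV: "A \<in> vspace V" "A' \<in> vspace V"
    unfolding A_def A'_def V_def using graph_vec_in_vspace[OF _ X12] D by blast+
  have finU: "finite (vspace U)" and finV': "finite (vspace V')"
    using U(1) V'(1) by (auto simp: label_permuting_def intro: finite_vspace_bit)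
  have sub: "fvs.subspace (F {a})" "F {a} \<subseteq> vspace V'" "finite (F {a})" if "a \<in> vspace V" for a
    using subspace_tensor_image[OF f, of "{a}"] that finite_subset[OF _ finV'] unfolding F_def by auto
  \<comment> \<open>\<open>F {a}\<close> is the image of the linear map y \<mapsto> f (a \<otimes>
    y) on \<open>U\<close>.\<close>
  have rank: "card (F {a}) * card {y \<in> vspace U. f (tensor_vec a y) = 0} = card (vspace U)"
    if a: "a \<in> vspace V" for a
  proof -
    have "linear_on (vspace U) fscale fscale (\<lambda>y. f (tensor_vec a y))"
      using f linear_on_tensor_vec[of "vspace U" a] tensor_vec_in_vspace[OF a, of _ U]
      unfolding equivariant_def linear_on_def by simp
    from card_image_times_card_kernel[OF this subspace_vspace finU]
    show ?thesis by (simp add: F_def tensor_image_singleton)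
  qed
  have ker: "{y \<in> vspace U. f (tensor_vec A' y) = 0} \<subset> {y \<in> vspace U. f (tensor_vec A y) = 0}"
    unfolding U_def f_def A_def A'_def kernel_adjacency_contraction[OF fin D(1) X12(1)]
      kernel_adjacency_contraction[OF fin D(2) X12(1)]
    unfolding \<Omega>_def by (rule fixed_vectors_twisted_psubset[OF G e\<^sub>0])
  have "card {y \<in> vspace U. f (tensor_vec A' y) = 0} < card {y \<in> vspace U. f (tensor_vec A y) = 0}"
    using psubset_card_mono[OF _ ker] finU by simp
  moreover have "card (F {A}) > 0"
    using sub[OF AV(1)] fvs.subspace_0 card_gt_0_iff by blast
  \<comment> \<open>Both products of image and kernel size equal the size of \<open>U\<close>.
    Replacing the kernel at \<open>A\<close> by the strictly smaller one at \<open>A'\<close> makes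
    the product too small, so the images differ in size.\<close>
  ultimately have "card (F {A}) * card {y \<in> vspace U. f (tensor_vec A' y) = 0} < card (vspace U)"
    unfolding rank[OF AV(1), symmetric] by (rule mult_less_mono2)
  then have neq: "card (F {A}) \<noteq> card (F {A'})"
    using rank[OF AV(2)] by auto
  have "\<not> isomorphic_in (approx_cat \<Omega> 3 V) {A} {A'}"
  proof
    assume "isomorphic_in (approx_cat \<Omega> 3 V) {A} {A'}"
    moreover have "{A} \<in> Obj (approx_cat \<Omega> 3 V)" "{A'} \<in> Obj (approx_cat \<Omega> 3 V)"
    proof -
      have "affine_set {a}" for a :: "('x cfi_vertex, bit) vec"
        unfolding affine_set_def
        by (intro disjI2 exI[of _ a] exI[of _ "{0}"]) (simp add: fvs.subspace_single_0)
      then show "{A} \<in> Obj (approx_cat \<Omega> 3 V)" "{A'} \<in> Obj (approx_cat \<Omega> 3 V)"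
        using AV by (simp_all add: approx_cat_def)
    qed
    ultimately have iso: "isomorphic_in (approx_cat \<Omega> 3 V') (F {A}) (F {A'})"
      using isomorphic_in_functor[OF vf] by blast
    \<comment> \<open>The level is weakened to 3 so that morphisms, being functionals on R_3, can be
      applied to the coefficients of \<open>V'\<close>.\<close>
    have l3: "coact_level \<Omega> 3 V'" using coact_level_mono[OF V'(2)] by simp
    note le = isomorphic_in_card_le[OF rep[OF V'(1)] l3]
    have "card (F {A}) = card (F {A'})"
      using le[OF sub(1,2)[OF AV(1)] sub[OF AV(2)] iso]
        le[OF sub(1,2)[OF AV(2)] sub[OF AV(1)] isomorphic_in_sym[OF iso]] by simp
    then show False using neq by simp
  qed
  moreover have "affine_dim (F {A}) \<noteq> affine_dim (F {A'})"
    using neq affine_dim_eq_iff_card_eq[OF sub(1,3)[OF AV(1)] sub(1,3)[OF AV(2)]] by simp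
  ultimately show ?thesis using rV' vf con by blast
qed

end
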